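(* Let $k\ge 2$ be an integer, let $0<|z|<1$ and put $t=-\log|z|^2$. Then $$\rho_{0,k+1}(z)=\frac{k}{2\pi}(1+\epsilon_t),$$ where $$|\epsilon_t|<\left(\frac{t^2}{\pi^2(k-1)}+2\,\frac{k+1}{k-1}\right)\left(1+\left(\frac{2\pi}{t}\right)^2\right)^{-(k+1)/2}.$$
   Context: For an integer $k\ge 2$, $\rho_{0,k}$ denotes the Bergman kernel function of the punctured unit disk $\mathbb D^*=\{z\in\mathbb C: 0<|z|<1\}$ with the Poincaré metric $\omega=\frac{i\,dz\wedge d\bar z}{|z|^2(\log\frac1{|z|^2})^2}$, i.e. of the Hilbert space $\mathcal H_{0,k}$ of holomorphic functions $f$ on $\mathbb D^*$ with $\int_{\mathbb D^*}|f|^2(\log\frac{1}{|z|^2})^k\,\omega<\infty$: $\rho_{0,k}=(\log\frac1{|z|^2})^k\sum_i|f_i|^2$ for an orthonormal basis $(f_i)$. Explicitly, $$\rho_{0,k}(z)=\frac{(\log \frac{1}{|z|^2})^k}{2\pi (k-2)!}\sum_{a=1}^{\infty}a^{k-1}|z|^{2a}.$$ *)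

theory Defs
  imports "HOL-Complex_Analysis.Complex_Analysis"
begin

definition punctured_disk :: "complex set" where
  "punctured_disk = {z. 0 < cmod z \<and> cmod z < 1}"

(* log (1/|z|^2): its k-th power is the Hermitian weight of the k-th tensor power. *)
definition log_weight :: "complex \<Rightarrow> real" where
  "log_weight z = ln (1 / (cmod z)\<^sup>2)"

(* The volume form omega = i dz /\ dzbar / (|z|^2 (log (1/|z|^2))^2) as a measure on the
   punctured disk; the factor 2 comes from i dz /\ dzbar = 2 dx /\ dy. *)
definition poincare_measure :: "complex measure" where
  "poincare_measure =
     density (restrict_space lborel punctured_disk)
       (\<lambda>z. ennreal (2 / ((cmod z)\<^sup>2 * (log_weight z)\<^sup>2)))"

(* Functions on the punctured disk are represented by total functions; their values elsewhere
   are arbitrary and enter neither the inner product nor the norm. *)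
definition bergman_space :: "nat \<Rightarrow> (complex \<Rightarrow> complex) set" where
  "bergman_space k =
     {f. f holomorphic_on punctured_disk \<and>
         integrable poincare_measure (\<lambda>z. (cmod (f z))\<^sup>2 * log_weight z ^ k)}"

definition bergman_inner :: "nat \<Rightarrow> (complex \<Rightarrow> complex) \<Rightarrow> (complex \<Rightarrow> complex) \<Rightarrow> complex" where
  "bergman_inner k f g =
     (LINT z|poincare_measure. f z * cnj (g z) * of_real (log_weight z ^ k))"

definition bergman_norm :: "nat \<Rightarrow> (complex \<Rightarrow> complex) \<Rightarrow> real" where
  "bergman_norm k f = sqrt (LINT z|poincare_measure. (cmod (f z))\<^sup>2 * log_weight z ^ k)"

(* An orthonormal set whose finite linear combinations are dense. Orthonormality prevents B from
   containing two representatives of the same function on the punctured disk. *)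
definition bergman_orthonormal_basis :: "nat \<Rightarrow> (complex \<Rightarrow> complex) set \<Rightarrow> bool" where
  "bergman_orthonormal_basis k B \<longleftrightarrow>
     B \<subseteq> bergman_space k \<and>
     (\<forall>f\<in>B. \<forall>g\<in>B. bergman_inner k f g = (if f = g then 1 else 0)) \<and>
     (\<forall>f\<in>bergman_space k. \<forall>e>0. \<exists>F c. finite F \<and> F \<subseteq> B \<and>
        bergman_norm k (\<lambda>z. f z - (\<Sum>b\<in>F. c b * b z)) < e)"

(* The value does not depend on which orthonormal basis is chosen. *)
definition bergman_kernel :: "nat \<Rightarrow> complex \<Rightarrow> real" where
  "bergman_kernel k z =
     log_weight z ^ k *
     (\<Sum>\<^sub>\<infinity>f\<in>(SOME B. bergman_orthonormal_basis k B). (cmod (f z))\<^sup>2)"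

end

theory Submission
  imports Defs
begin

text \<open>
  The Bergman space of the punctured disk has an orthogonal basis of monomials \<open>z ^ a\<close> with
  \<open>a \<ge> 1\<close>: by rotation invariance the inner product of \<open>f\<close> with \<open>z ^ a\<close> is a multiple of the Fourier
  coefficient of \<open>f\<close> on circles, and square integrability at the puncture kills the coefficients with
  \<open>a \<le> 0\<close>. Parseval's identity, applied to the reproducing kernel function, shows that every
  orthonormal basis gives the same value of the Bergman kernel, namely
  \<open>(k / 2\<pi>) (t ^ (k+1) / k!) \<Sum> n ^ k exp (- n t)\<close> with \<open>t = - ln |z|\<^sup>2\<close>.
  Lipschitz' formula (the \<open>k\<close>-th derivative of the partial fraction expansion of the cotangent) turns
  this into \<open>(k / 2\<pi>) \<Sum> (1 + 2\<pi>in/t) ^ (-k-1)\<close> over all integers \<open>n\<close>. The term \<open>n = 0\<close> is the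
  main term, \<open>n = \<plusminus>1\<close> contribute \<open>2 (1 + (2\<pi>/t)\<^sup>2) ^ (-(k+1)/2)\<close> to the error bound, and the
  remaining terms are dominated by the integral of \<open>y (1 + (2\<pi>y/t)\<^sup>2) ^ (-(k+1)/2)\<close> over \<open>y \<ge> 1\<close>.
\<close>

text \<open>The kernel is defined through an orthonormal basis picked by \<open>SOME\<close>, about
  which nothing else is known. As a basis, the monomials only make this choice meaningful; the value
  has to be computed for an arbitrary basis. Laurent series are avoided: a function is studied
  through its means over circles, which for holomorphic integrands do not depend on the radius. No
  pointwise bound near the puncture is used. Square integrability yields circles arbitrarily close
  to 0 with small mean square, and this suffices to shrink the circle into the puncture. Constants:
  let x = 2 pi / t and A = (1 + x^2)^(-(k+1)/2). The tail integral equals A (1 + x^2) / (x^2 (k-1)),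
  so both signs of n together give A (2 / (x^2 (k-1)) + 2 / (k-1)). Since t^2 / pi^2 = 4 / x^2 and 2
  (k+1) / (k-1) = 2 + 4 / (k-1), the stated bound is the contribution 2 A of n = \<plusminus>1 plus
  twice this tail bound. The surplus gives the strict inequality.\<close>

unbundle no fps_syntax

subsection \<open>Rotation invariance of Lebesgue measure\<close>

text \<open>Boxes determine Lebesgue measure, and the coordinate map pulls boxes back to boxes. This
  transports rotation invariance from \<open>real^2\<close>, where orthogonal maps are treated, to
  \<open>complex\<close>.\<close>

lemma distr_lborel_vec2_complex:
  "distr (lborel :: (real^2) measure) borel (\<lambda>v. Complex (v $ 1) (v $ 2)) = lborel"
proof (rule lborel_eqI[symmetric])
  have meas [measurable]: "(\<lambda>v::real^2. Complex (v $ 1) (v $ 2)) \<in> borel_measurable borel"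
    by (intro borel_measurable_continuous_onI)
      (auto simp: Complex_eq intro!: continuous_intros)
  fix l u :: complex
  assume le: "\<And>b. b \<in> Basis \<Longrightarrow> l \<bullet> b \<le> u \<bullet> b"
  have vim: "(\<lambda>v::real^2. Complex (v $ 1) (v $ 2)) -` box l u =
      box (vector [Re l, Im l]) (vector [Re u, Im u])"
    by (auto simp: box_def Basis_complex_def Basis_vec_def inner_axis forall_2 UNIV_2)
  have "emeasure (distr (lborel :: (real^2) measure) borel (\<lambda>v. Complex (v $ 1) (v $ 2))) (box l u)
      = emeasure lborel (box (vector [Re l, Im l] :: real^2) (vector [Re u, Im u]))"
    by (subst emeasure_distr) (auto simp: vim)
  also have "\<dots> = (\<Prod>b\<in>Basis. ((vector [Re u, Im u] :: real^2) - vector [Re l, Im l]) \<bullet> b)"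
    using le[of 1] le[of \<i>] by (intro emeasure_lborel_box)
      (auto simp: Basis_complex_def Basis_vec_def inner_axis forall_2 UNIV_2)
  also have "(Basis :: (real^2) set) = {axis 1 1, axis 2 1}"
    by (auto simp: Basis_vec_def UNIV_2)
  also have "(\<Prod>b\<in>{axis 1 1, axis 2 1}. ((vector [Re u, Im u] :: real^2) - vector [Re l, Im l]) \<bullet> b)
     = (Re u - Re l) * (Im u - Im l)"
    by (subst prod.insert) (auto simp: axis_eq_axis inner_axis)
  also have "\<dots> = (\<Prod>b\<in>Basis. (u - l) \<bullet> b)"
    by (simp add: Basis_complex_def)
  finally show "emeasure (distr (lborel :: (real^2) measure) borel (\<lambda>v. Complex (v $ 1) (v $ 2))) (box l u)
     = (\<Prod>b\<in>Basis. (u - l) \<bullet> b)" .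
qed simp

text \<open>The preimage of a box is its image under the orthogonal map \<open>inv f\<close>, so
  \<open>measure_orthogonal_image\<close> gives its measure. That fact speaks of the completed
  measure; the image is Borel, so \<open>lborel\<close> assigns the same value.\<close>

lemma lborel_distr_orthogonal_transformation:
  fixes f :: "real^'n::{finite,wellorder} \<Rightarrow> real^'n::_"
  assumes f: "orthogonal_transformation f"
  shows "distr lborel borel f = lborel"
proof (rule lborel_eqI[symmetric])
  have lin: "linear f" using f by (rule orthogonal_transformation_linear)
  have meas [measurable]: "f \<in> borel_measurable borel"
    using lin by (intro borel_measurable_continuous_onI linear_continuous_on linear_linear[THEN iffD2])
  fix l u :: "real^'n::_"
  assume le: "\<And>b. b \<in> Basis \<Longrightarrow> l \<bullet> b \<le> u \<bullet> b"
  have g: "orthogonal_transformation (inv f)"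
    using f by (rule orthogonal_transformation_inv)
  have "bij f" using f by (rule orthogonal_transformation_bij)
  then have vim: "f -` box l u = inv f ` box l u"
    by (rule bij_vimage_eq_inv_image)
  have bx: "box l u \<in> lmeasurable" by simp
  have "inv f ` box l u \<in> lmeasurable"
    by (rule measurable_orthogonal_image[OF g bx])
  moreover have b: "inv f ` box l u \<in> sets borel"
    using measurable_sets_borel[OF meas, of "box l u"] vim by simp
  ultimately have "emeasure lborel (inv f ` box l u) = measure lebesgue (inv f ` box l u)"
    using emeasure_eq_measure2[of "inv f ` box l u" lebesgue] emeasure_completion[of "inv f ` box l u" lborel] by simp
  also have "\<dots> = ennreal (measure lebesgue (box l u))"
    by (simp add: measure_orthogonal_image[OF g bx])
  also have "\<dots> = (\<Prod>b\<in>Basis. (u - l) \<bullet> b)"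
    using le by (simp add: measure_lborel_box)
  finally show "emeasure (distr lborel borel f) (box l u) = (\<Prod>b\<in>Basis. (u - l) \<bullet> b)"
    by (subst emeasure_distr) (auto simp: vim)
qed simp

lemma lborel_distr_mult_unimodular:
  fixes c :: complex
  assumes c: "cmod c = 1"
  shows "distr lborel borel ((*) c) = lborel"
proof -
  let ?\<phi> = "\<lambda>v::real^2. Complex (v $ 1) (v $ 2)"
  \<comment> \<open>\<open>R\<close> is multiplication by \<open>c\<close> in real coordinates, an
    orthogonal map because \<open>cmod c = 1\<close>.\<close>
  define R :: "real^2 \<Rightarrow> real^2" where
    "R = (\<lambda>v. vector [Re c * v $ 1 - Im c * v $ 2, Re c * v $ 2 + Im c * v $ 1])"
  have nc: "(Re c)\<^sup>2 + (Im c)\<^sup>2 = 1"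
    using c by (metis cmod_power2 one_power2)
  have [measurable]: "?\<phi> \<in> borel_measurable borel"
    by (intro borel_measurable_continuous_onI)
      (auto simp: Complex_eq intro!: continuous_intros)
  have R: "orthogonal_transformation R"
    unfolding orthogonal_transformation
  proof
    show "linear R"
      by (intro linearI) (auto simp: R_def vec_eq_iff forall_2 algebra_simps)
    show "\<forall>v. norm (R v) = norm v"
    proof
      fix v :: "real^2"
      have "(Re c * v $ 1 - Im c * v $ 2)\<^sup>2 + (Re c * v $ 2 + Im c * v $ 1)\<^sup>2
          = ((Re c)\<^sup>2 + (Im c)\<^sup>2) * ((v$1)\<^sup>2 + (v$2)\<^sup>2)"
        by (simp add: power2_eq_square algebra_simps)
      then show "norm (R v) = norm v"
        by (simp add: norm_vec_def L2_set_def sum_2 R_def nc)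
    qed
  qed
  have [measurable]: "R \<in> borel_measurable borel"
    using orthogonal_transformation_linear[OF R]
    by (intro borel_measurable_continuous_onI linear_continuous_on linear_linear[THEN iffD2])
  have eq: "(*) c \<circ> ?\<phi> = ?\<phi> \<circ> R"
    by (auto simp: R_def complex_eq_iff fun_eq_iff algebra_simps)
  have "distr lborel borel ((*) c) = distr (distr lborel borel ?\<phi>) borel ((*) c)"
    by (simp only: distr_lborel_vec2_complex)
  also have "\<dots> = distr lborel borel ((*) c \<circ> ?\<phi>)"
    by (subst distr_distr) auto
  also have "\<dots> = distr (distr lborel borel R) borel ?\<phi>"
    unfolding eq by (subst distr_distr) auto
  also have "\<dots> = lborel"
    by (simp only: lborel_distr_orthogonal_transformation[OF R] distr_lborel_vec2_complex)
  finally show ?thesis .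
qed

subsection \<open>The Poincare measure on the punctured disk\<close>

lemma zero_notin_punctured_disk [simp]: "0 \<notin> punctured_disk"
  by (simp add: punctured_disk_def)

lemma punctured_disk_eq: "punctured_disk = ball 0 1 - {0}"
  by (auto simp: punctured_disk_def)

lemma open_punctured_disk: "open punctured_disk"
  by (simp add: punctured_disk_eq open_delete)

lemma connected_punctured_disk: "connected punctured_disk"
  unfolding punctured_disk_eq by (rule connected_punctured_ball) simp

lemma punctured_disk_borel [measurable]: "punctured_disk \<in> sets borel"
  using open_punctured_disk by simp

lemma mult_unimodular_in_punctured_disk_iff:
  "cmod c = 1 \<Longrightarrow> z * c \<in> punctured_disk \<longleftrightarrow> z \<in> punctured_disk"
  by (auto simp: punctured_disk_def norm_mult)

lemma log_weight_eq: "z \<noteq> 0 \<Longrightarrow> log_weight z = - 2 * ln (cmod z)"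
  by (simp add: log_weight_def ln_div ln_realpow)

lemma log_weight_pos: "z \<in> punctured_disk \<Longrightarrow> 0 < log_weight z"
  by (auto simp: log_weight_eq punctured_disk_def)

lemma log_weight_nonneg: "z \<in> punctured_disk \<Longrightarrow> 0 \<le> log_weight z"
  using log_weight_pos by (rule less_imp_le)

lemma exp_log_weight: "z \<noteq> 0 \<Longrightarrow> exp (- log_weight z) = (cmod z)\<^sup>2"
  by (simp add: log_weight_def ln_div exp_minus)

lemma log_weight_mult_unimodular: "cmod c = 1 \<Longrightarrow> log_weight (z * c) = log_weight z"
  by (simp add: log_weight_def norm_mult)

lemma log_weight_measurable [measurable]: "log_weight \<in> borel_measurable borel"
  unfolding log_weight_def by measurable

lemma continuous_on_log_weight: "continuous_on punctured_disk log_weight"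
  unfolding log_weight_def
  by (intro continuous_intros) (auto simp: punctured_disk_def)

lemma space_poincare_measure [simp]: "space poincare_measure = punctured_disk"
  by (simp add: poincare_measure_def space_restrict_space)

lemma sets_poincare_measure [measurable_cong]:
  "sets poincare_measure = sets (restrict_space borel punctured_disk)"
  by (simp add: poincare_measure_def sets_restrict_space)

lemma borel_measurable_poincareI:
  fixes f :: "complex \<Rightarrow> 'a :: topological_space"
  shows "f \<in> borel_measurable borel \<Longrightarrow> f \<in> borel_measurable poincare_measure"
  unfolding measurable_cong_sets[OF sets_poincare_measure refl]
  by (rule measurable_restrict_space1)

lemma borel_measurable_poincare_continuous:
  fixes f :: "complex \<Rightarrow> 'a :: topological_space"
  assumes "continuous_on punctured_disk f"
  shows "f \<in> borel_measurable poincare_measure"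
  unfolding measurable_cong_sets[OF sets_poincare_measure refl]
  by (rule borel_measurable_continuous_on_restrict[OF assms])

lemma restrict_lborel_weight_measurable [measurable]:
  "(\<lambda>z. 2 / ((cmod z)\<^sup>2 * (log_weight z)\<^sup>2)) \<in>
     borel_measurable (restrict_space lborel punctured_disk)"
  by (intro measurable_restrict_space1) measurable

lemma nn_integral_poincare:
  assumes "f \<in> borel_measurable poincare_measure"
  shows "(\<integral>\<^sup>+z. f z \<partial>poincare_measure) =
    (\<integral>\<^sup>+z. ennreal (2 / ((cmod z)\<^sup>2 * (log_weight z)\<^sup>2)) * f z \<partial>restrict_space lborel punctured_disk)"
  using assms unfolding poincare_measure_def
  by (subst nn_integral_density) auto

lemma emeasure_poincare:
  assumes A: "A \<in> sets poincare_measure"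
  shows "emeasure poincare_measure A =
    (\<integral>\<^sup>+z. ennreal (2 / ((cmod z)\<^sup>2 * (log_weight z)\<^sup>2)) * indicator A z \<partial>lborel)"
proof -
  have sub: "A \<subseteq> punctured_disk"
    using sets.sets_into_space[OF A] by simp
  have "emeasure poincare_measure A = (\<integral>\<^sup>+z. indicator A z \<partial>poincare_measure)"
    using A by simp
  also have "\<dots> = (\<integral>\<^sup>+z. ennreal (2 / ((cmod z)\<^sup>2 * (log_weight z)\<^sup>2)) * indicator A z
      \<partial>restrict_space lborel punctured_disk)"
    using A by (intro nn_integral_poincare) simp
  also have "\<dots> = (\<integral>\<^sup>+z. ennreal (2 / ((cmod z)\<^sup>2 * (log_weight z)\<^sup>2)) * indicator A z
      * indicator punctured_disk z \<partial>lborel)"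
    by (subst nn_integral_restrict_space) auto
  also have "\<dots> = (\<integral>\<^sup>+z. ennreal (2 / ((cmod z)\<^sup>2 * (log_weight z)\<^sup>2)) * indicator A z \<partial>lborel)"
    using sub by (intro nn_integral_cong) (auto simp: indicator_def)
  finally show ?thesis .
qed

section \<open>Rotation invariance and sigma-finiteness of the Poincare measure\<close>

lemma mult_unimodular_measurable_poincare:
  assumes c: "cmod c = 1"
  shows "(\<lambda>z. z * c) \<in> poincare_measure \<rightarrow>\<^sub>M poincare_measure"
proof -
  have "(\<lambda>z. z * c) \<in> restrict_space borel punctured_disk \<rightarrow>\<^sub>M restrict_space borel punctured_disk"
    using c by (intro measurable_restrict_space2 measurable_restrict_space1)
      (auto simp: space_restrict_space mult_unimodular_in_punctured_disk_iff)
  then show ?thesis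
    by (simp add: measurable_cong_sets[OF sets_poincare_measure sets_poincare_measure])
qed

text \<open>The density depends on \<open>cmod z\<close> alone, so the claim reduces to the
  invariance of \<open>lborel\<close>.\<close>

lemma distr_poincare_mult_unimodular:
  assumes c: "cmod c = 1"
  shows "distr poincare_measure poincare_measure (\<lambda>z. z * c) = poincare_measure"
proof (rule measure_eqI)
  note meas = mult_unimodular_measurable_poincare[OF c]
  let ?w = "\<lambda>z. ennreal (2 / ((cmod z)\<^sup>2 * (log_weight z)\<^sup>2))"
  fix A assume "A \<in> sets (distr poincare_measure poincare_measure (\<lambda>z. z * c))"
  then have A: "A \<in> sets poincare_measure" by simp
  then have A_pd: "A \<subseteq> punctured_disk"
    using sets.sets_into_space by fastforce
  have Ab [measurable]: "A \<in> sets borel"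
    using A by (auto simp: sets_poincare_measure sets_restrict_space)
  have B: "(\<lambda>z. z * c) -` A \<inter> space poincare_measure \<in> sets poincare_measure"
    by (rule measurable_sets[OF meas A])
  have ind: "indicator ((\<lambda>z. z * c) -` A \<inter> space poincare_measure) z = (indicator A (c * z) :: ennreal)" for z
  proof -
    have "z \<in> punctured_disk" if "z * c \<in> A"
      using that A_pd mult_unimodular_in_punctured_disk_iff[OF c, of z] by blast
    then show ?thesis
      by (auto simp: indicator_def mult.commute[of c])
  qed
  have w: "?w z = ?w (c * z)" for z
    using c by (simp add: norm_mult log_weight_mult_unimodular mult.commute[of c])
  have "emeasure (distr poincare_measure poincare_measure (\<lambda>z. z * c)) A
      = (\<integral>\<^sup>+z. ?w z * indicator ((\<lambda>z. z * c) -` A \<inter> space poincare_measure) z \<partial>lborel)"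
    by (simp only: emeasure_distr[OF meas A] emeasure_poincare[OF B])
  also have "\<dots> = (\<integral>\<^sup>+z. ?w (c * z) * indicator A (c * z) \<partial>lborel)"
    by (intro nn_integral_cong) (simp only: ind w[symmetric])
  also have "\<dots> = (\<integral>\<^sup>+z. ?w z * indicator A z \<partial>distr lborel borel ((*) c))"
    by (subst nn_integral_distr) auto
  also have "\<dots> = emeasure poincare_measure A"
    by (simp only: lborel_distr_mult_unimodular[OF c] emeasure_poincare[OF A])
  finally show "emeasure (distr poincare_measure poincare_measure (\<lambda>z. z * c)) A
      = emeasure poincare_measure A" .
qed simp

text \<open>Fubini needs this, because the total mass is infinite: the density diverges too fast at
  the unit circle.\<close>

lemma sigma_finite_poincare_measure: "sigma_finite_measure poincare_measure"
proof -
  interpret R: sigma_finite_measure "restrict_space (lborel :: complex measure) punctured_disk"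
    by (intro sigma_finite_measure_restrict_space) (auto intro: sigma_finite_lborel)
  show ?thesis
    unfolding poincare_measure_def
    by (subst R.sigma_finite_iff_density_finite) auto
qed

section \<open>Radial integrals in the variable t = log (1 / |z|^2)\<close>

text \<open>The set where \<open>log_weight\<close> exceeds x \<ge> 0 is a punctured disk of radius
  exp (-x/2), hence of area pi exp (-x). Measures on the line that are finite on the rays
  \<open>{x<..}\<close> are determined by these values.\<close>

lemma distr_lborel_log_weight:
  "distr (restrict_space lborel punctured_disk) borel log_weight =
     density lborel (\<lambda>t. ennreal (pi * exp (- t)) * indicator {0..} t)"
proof (rule measure_eqI_lessThan)
  have [measurable]: "log_weight \<in> borel_measurable (restrict_space lborel punctured_disk)"
    by (intro measurable_restrict_space1) simp
  have L: "emeasure (distr (restrict_space lborel punctured_disk) borel log_weight) {x<..}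
      = ennreal (pi * exp (- max x 0))" for x
  proof -
    \<comment> \<open>For negative \<open>x\<close> the condition \<open>log_weight z > x\<close>
      holds on the whole punctured disk, so the radius is cut off at 1.\<close>
    let ?r = "exp (- max x 0 / 2)"
    have "log_weight -` {x<..} \<inter> punctured_disk = ball 0 ?r - {0}"
    proof (intro set_eqI)
      fix z
      show "z \<in> log_weight -` {x<..} \<inter> punctured_disk \<longleftrightarrow> z \<in> ball 0 ?r - {0}"
      proof (cases "z = 0")
        case False
        have "z \<in> ball 0 ?r - {0} \<longleftrightarrow> ln (cmod z) < - max x 0 / 2"
          using False by (metis Diff_iff dist_0_norm exp_less_cancel_iff exp_ln mem_ball singletonD zero_less_norm_iff)
        also have "\<dots> \<longleftrightarrow> - 2 * ln (cmod z) > x \<and> ln (cmod z) < 0"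
          by auto
        finally show ?thesis
          using False by (auto simp: log_weight_eq punctured_disk_def)
      qed simp
    qed
    then have vim: "log_weight -` {x<..} \<inter> space (restrict_space lborel punctured_disk) = ball 0 ?r - {0}"
      by (simp add: space_restrict_space)
    have "?r \<le> 1" by simp
    then have sub: "ball 0 ?r - {0} \<subseteq> punctured_disk"
      unfolding punctured_disk_eq by (intro Diff_mono subset_ball) auto
    have "emeasure (distr (restrict_space lborel punctured_disk) borel log_weight) {x<..}
       = emeasure (restrict_space lborel punctured_disk) (ball 0 ?r - {0})"
      by (subst emeasure_distr) (simp_all only: vim, simp_all)
    also have "\<dots> = emeasure lborel (ball (0::complex) ?r - {0})"
      using sub by (intro emeasure_restrict_space) auto
    also have "\<dots> = emeasure lborel (ball (0::complex) ?r)"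
      by (subst emeasure_Diff) auto
    also have "\<dots> = ennreal (pi * ?r ^ 2)"
      by (subst emeasure_ball) (auto simp: eval_unit_ball_vol)
    also have "?r ^ 2 = exp (- max x 0)"
      by (simp flip: exp_double)
    finally show ?thesis .
  qed
  then show "emeasure (distr (restrict_space lborel punctured_disk) borel log_weight) {x<..} < \<infinity>" for x
    by simp
  show "emeasure (distr (restrict_space lborel punctured_disk) borel log_weight) {x<..} =
    emeasure (density lborel (\<lambda>t. ennreal (pi * exp (- t)) * indicator {0..} t)) {x<..}" for x
  proof -
    have "emeasure (density lborel (\<lambda>t. ennreal (pi * exp (- t)) * indicator {0..} t)) {x<..} =
       (\<integral>\<^sup>+t. ennreal (pi * exp (- t)) * indicator {0..} t * indicator {x<..} t \<partial>lborel)"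
      by (subst emeasure_density) auto
    also have "\<dots> = (\<integral>\<^sup>+t. ennreal (pi * exp (- t)) * indicator {max x 0..} t \<partial>lborel)"
    proof (rule nn_integral_cong_AE)
      show "AE t in lborel. ennreal (pi * exp (- t)) * indicator {0..} t * indicator {x<..} t =
          ennreal (pi * exp (- t)) * indicator {max x 0..} t"
        using AE_lborel_singleton[of x] by eventually_elim (auto split: split_indicator)
    qed
    also have "\<dots> = ennreal (0 - (- (pi * exp (- max x 0))))"
    proof (rule nn_integral_FTC_atLeast)
      have "((\<lambda>t::real. - (pi * exp (- t))) \<longlongrightarrow> - (pi * 0)) at_top"
        by (intro tendsto_intros filterlim_compose[OF exp_at_bot] filterlim_uminus_at_bot_at_top)
      then show "((\<lambda>t::real. - (pi * exp (- t))) \<longlongrightarrow> 0) at_top" by simp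
    qed (auto intro!: derivative_eq_intros)
    finally show ?thesis using L by simp
  qed
qed auto

text \<open>With |z|^2 = exp (-t) the density of the Poincare measure reads 2 exp t / t^2. The
  exponential cancels against the factor pi exp (-t) of the pushed-forward Lebesgue measure and
  leaves 2 pi / t^2.\<close>

lemma nn_integral_poincare_log_weight:
  assumes [measurable]: "g \<in> borel_measurable borel"
  shows "(\<integral>\<^sup>+z. g (log_weight z) \<partial>poincare_measure) =
    (\<integral>\<^sup>+t. ennreal (2 * pi / t\<^sup>2) * g t * indicator {0..} t \<partial>lborel)"
proof -
  have [measurable]: "log_weight \<in> borel_measurable (restrict_space lborel punctured_disk)"
    by (intro measurable_restrict_space1) simp
  have "(\<integral>\<^sup>+z. g (log_weight z) \<partial>poincare_measure) =
    (\<integral>\<^sup>+z. ennreal (2 / ((cmod z)\<^sup>2 * (log_weight z)\<^sup>2)) * g (log_weight z) \<partial>restrict_space lborel punctured_disk)"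
    by (intro nn_integral_poincare borel_measurable_poincareI) simp
  also have "\<dots> = (\<integral>\<^sup>+z. ennreal (2 * exp (log_weight z) / (log_weight z)\<^sup>2) * g (log_weight z) \<partial>restrict_space lborel punctured_disk)"
  proof (intro nn_integral_cong)
    fix z assume "z \<in> space (restrict_space lborel punctured_disk)"
    then have "z \<noteq> 0" by (auto simp: space_restrict_space)
    then have "2 / ((cmod z)\<^sup>2 * (log_weight z)\<^sup>2) = 2 * exp (log_weight z) / (log_weight z)\<^sup>2"
      by (simp add: exp_log_weight[symmetric] exp_minus field_simps)
    then show "ennreal (2 / ((cmod z)\<^sup>2 * (log_weight z)\<^sup>2)) * g (log_weight z) =
        ennreal (2 * exp (log_weight z) / (log_weight z)\<^sup>2) * g (log_weight z)"
      by simp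
  qed
  also have "\<dots> = (\<integral>\<^sup>+t. ennreal (2 * exp t / t\<^sup>2) * g t \<partial>distr (restrict_space lborel punctured_disk) borel log_weight)"
    by (subst nn_integral_distr) auto
  also have "\<dots> = (\<integral>\<^sup>+t. (ennreal (pi * exp (- t)) * indicator {0..} t) * (ennreal (2 * exp t / t\<^sup>2) * g t) \<partial>lborel)"
    unfolding distr_lborel_log_weight by (subst nn_integral_density) auto
  also have "\<dots> = (\<integral>\<^sup>+t. ennreal (2 * pi / t\<^sup>2) * g t * indicator {0..} t \<partial>lborel)"
  proof (intro nn_integral_cong)
    fix t :: real
    have "ennreal (2 * pi / t\<^sup>2) = ennreal (pi * exp (- t)) * ennreal (2 * exp t / t\<^sup>2)"
      by (subst ennreal_mult[symmetric]) (auto simp: exp_minus field_simps)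
    then show "(ennreal (pi * exp (- t)) * indicator {0..} t) * (ennreal (2 * exp t / t\<^sup>2) * g t) =
        ennreal (2 * pi / t\<^sup>2) * g t * indicator {0..} t"
      by (simp add: ac_simps)
  qed
  finally show ?thesis .
qed

lemma nn_integral_power_times_exp:
  fixes a :: real
  assumes a: "0 < a"
  shows "(\<integral>\<^sup>+t. ennreal (t ^ n * exp (- a * t)) * indicator {0..} t \<partial>lborel) = ennreal (fact n / a ^ Suc n)"
proof -
  have "ennreal (fact n) = ennreal (Gamma (real n + 1))"
    by (simp only: Gamma_fact add.commute[of _ 1])
  also have "\<dots> = (\<integral>\<^sup>+t. ennreal (indicator {0..} t * t powr (real n + 1 - 1) / exp t) \<partial>lborel)"
    by (intro Gamma_conv_nn_integral_real) simp
  also have "\<dots> = (\<integral>\<^sup>+t. ennreal (t ^ n * exp (- t)) * indicator {0..} t \<partial>lborel)"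
  proof (rule nn_integral_cong_AE)
    \<comment> \<open>The point 0 has to be excluded: for \<open>n = 0\<close> the left side there
      uses \<open>0 powr 0 = 0\<close>, the right side \<open>0 ^ 0 = 1\<close>.\<close>
    show "AE t in lborel. ennreal (indicator {0..} t * t powr (real n + 1 - 1) / exp t) =
        ennreal (t ^ n * exp (- t)) * indicator {0..} t"
      using AE_lborel_singleton[of 0]
      by eventually_elim (auto simp: powr_realpow exp_minus field_simps split: split_indicator)
  qed
  also have "\<dots> = ennreal \<bar>a\<bar> * (\<integral>\<^sup>+t. ennreal ((0 + a * t) ^ n * exp (- (0 + a * t))) * indicator {0..} (0 + a * t) \<partial>lborel)"
    using a by (intro nn_integral_real_affine) auto
  also have "\<dots> = ennreal \<bar>a\<bar> * (\<integral>\<^sup>+t. ennreal (a ^ n) * (ennreal (t ^ n * exp (- a * t)) * indicator {0..} t) \<partial>lborel)"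
  proof (rule arg_cong[where f = "\<lambda>x. ennreal \<bar>a\<bar> * x"], rule nn_integral_cong)
    fix t :: real
    show "ennreal ((0 + a * t) ^ n * exp (- (0 + a * t))) * indicator {0..} (0 + a * t)
        = ennreal (a ^ n) * (ennreal (t ^ n * exp (- a * t)) * indicator {0..} t)"
      using a by (auto simp: indicator_def power_mult_distrib zero_le_mult_iff mult.assoc simp flip: ennreal_mult)
  qed
  also have "\<dots> = ennreal (a ^ Suc n) * (\<integral>\<^sup>+t. ennreal (t ^ n * exp (- a * t)) * indicator {0..} t \<partial>lborel)"
    using a by (subst nn_integral_cmult) (auto simp: mult.assoc[symmetric] simp flip: ennreal_mult)
  finally have eq: "ennreal (fact n) = ennreal (a ^ Suc n) * (\<integral>\<^sup>+t. ennreal (t ^ n * exp (- a * t)) * indicator {0..} t \<partial>lborel)" .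
  have "ennreal (fact n / a ^ Suc n) = ennreal (1 / a ^ Suc n) * ennreal (fact n)"
    using a by (subst ennreal_mult[symmetric]) auto
  also have "\<dots> = (ennreal (1 / a ^ Suc n) * ennreal (a ^ Suc n)) * (\<integral>\<^sup>+t. ennreal (t ^ n * exp (- a * t)) * indicator {0..} t \<partial>lborel)"
    by (subst eq) (simp only: mult.assoc)
  also have "ennreal (1 / a ^ Suc n) * ennreal (a ^ Suc n) = 1"
    using a by (subst ennreal_mult[symmetric]) auto
  finally show ?thesis by simp
qed

text \<open>This is the squared norm of z^a. Here |z|^(2a) = exp (-a t), and the factor 1 / t^2 of
  the measure lowers t^k to t^(k-2), which leaves a Gamma integral.\<close>

lemma nn_integral_poincare_monomial:
  assumes "a \<ge> 1" "k \<ge> 2"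
  shows "(\<integral>\<^sup>+z. ennreal (cmod z ^ (2 * a) * log_weight z ^ k) \<partial>poincare_measure) =
    ennreal (2 * pi * fact (k - 2) / real a ^ (k - 1))"
proof -
  have "(\<integral>\<^sup>+z. ennreal (cmod z ^ (2 * a) * log_weight z ^ k) \<partial>poincare_measure) =
    (\<integral>\<^sup>+z. ennreal (exp (- real a * log_weight z) * log_weight z ^ k) \<partial>poincare_measure)"
  proof (intro nn_integral_cong)
    fix z assume "z \<in> space poincare_measure"
    then have "z \<noteq> 0" by auto
    then have "cmod z ^ (2 * a) = exp (- log_weight z) ^ a"
      by (simp add: exp_log_weight power_mult)
    also have "\<dots> = exp (- real a * log_weight z)"
      by (simp flip: exp_of_nat_mult)
    finally show "ennreal (cmod z ^ (2 * a) * log_weight z ^ k) =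
       ennreal (exp (- real a * log_weight z) * log_weight z ^ k)" by simp
  qed
  also have "\<dots> = (\<integral>\<^sup>+t. ennreal (2 * pi / t\<^sup>2) * ennreal (exp (- real a * t) * t ^ k) * indicator {0..} t \<partial>lborel)"
    by (rule nn_integral_poincare_log_weight) simp
  also have "\<dots> = (\<integral>\<^sup>+t. ennreal (2 * pi) * (ennreal (t ^ (k - 2) * exp (- real a * t)) * indicator {0..} t) \<partial>lborel)"
  proof (rule nn_integral_cong_AE, rule AE_mp[OF AE_lborel_singleton[of 0]], rule AE_I2, rule impI)
    \<comment> \<open>At \<open>t = 0\<close> the two sides can differ, because
      \<open>2 * pi / 0 = 0\<close> while \<open>t ^ (k - 2)\<close> is 1 for
      \<open>k = 2\<close>.\<close>
    fix t :: real assume t: "t \<noteq> 0"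
    have tk: "t ^ k = t ^ (k - 2) * t\<^sup>2"
      using \<open>k \<ge> 2\<close> by (metis power_add le_add_diff_inverse2)
    show "ennreal (2 * pi / t\<^sup>2) * ennreal (exp (- real a * t) * t ^ k) * indicator {0..} t =
        ennreal (2 * pi) * (ennreal (t ^ (k - 2) * exp (- real a * t)) * indicator {0..} t)"
      using t unfolding tk by (auto simp: indicator_def mult_ac simp flip: ennreal_mult)
  qed
  also have "\<dots> = ennreal (2 * pi) * (\<integral>\<^sup>+t. (ennreal (t ^ (k - 2) * exp (- real a * t)) * indicator {0..} t) \<partial>lborel)"
    by (intro nn_integral_cmult) simp
  also have "\<dots> = ennreal (2 * pi) * ennreal (fact (k - 2) / real a ^ Suc (k - 2))"
    using \<open>a \<ge> 1\<close> by (subst nn_integral_power_times_exp) auto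
  also have "Suc (k - 2) = k - 1"
    using \<open>k \<ge> 2\<close> by simp
  finally show ?thesis
    by (simp flip: ennreal_mult)
qed

text \<open>The puncture corresponds to t tending to infinity, where t^k * 2 pi / t^2 stays above 1
  for k \<ge> 2. All vanishing of coefficients at the puncture comes from this divergence.\<close>

lemma nn_integral_poincare_near_0:
  assumes "0 < d" "k \<ge> 2"
  shows "(\<integral>\<^sup>+z. ennreal (log_weight z ^ k) * indicator {z. cmod z < d} z \<partial>poincare_measure) = \<infinity>"
proof -
  \<comment> \<open>\<open>- 2 * ln d\<close> is the value of t on the circle of radius
    \<open>d\<close>; the bound 1 ensures t^2 \<le> t^k.\<close>
  define T where "T = max 1 (- 2 * ln d)"
  have "(\<integral>\<^sup>+t. indicator {T<..} t \<partial>lborel) = emeasure lborel {T<..}"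
    by simp
  also have "\<dots> = \<infinity>"
  proof -
    have "ennreal (real n) \<le> emeasure lborel {T<..}" for n :: nat
    proof -
      have "ennreal (real n) = emeasure lborel {T<..T + real n}" by simp
      also have "\<dots> \<le> emeasure lborel {T<..}" by (intro emeasure_mono) auto
      finally show ?thesis .
    qed
    then show ?thesis
      by (metis ennreal_of_nat_eq_real_of_nat infinity_ennreal_def ennreal_Ex_less_of_nat less_le_not_le top.not_eq_extremum)
  qed
  finally have "\<infinity> = (\<integral>\<^sup>+t. indicator {T<..} t \<partial>lborel)" by simp
  also have "\<dots> \<le> (\<integral>\<^sup>+t. ennreal (2 * pi / t\<^sup>2) * (ennreal (t ^ k) * indicator {T<..} t) * indicator {0..} t \<partial>lborel)"
  proof (intro nn_integral_mono)
    fix t :: real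
    show "indicator {T<..} t \<le> ennreal (2 * pi / t\<^sup>2) * (ennreal (t ^ k) * indicator {T<..} t) * indicator {0..} t"
    proof (cases "T < t")
      case True
      then have t: "1 < t" by (simp add: T_def)
      have "t\<^sup>2 \<le> t ^ k" using t \<open>k \<ge> 2\<close> by (intro power_increasing) auto
      also have "\<dots> \<le> 2 * pi * t ^ k" using t pi_gt3 by simp
      finally have "1 \<le> 2 * pi / t\<^sup>2 * t ^ k" using t by (simp add: field_simps)
      then have "ennreal 1 \<le> ennreal (2 * pi / t\<^sup>2) * ennreal (t ^ k)"
        using t by (subst ennreal_mult[symmetric]) (auto intro: ennreal_leI simp del: ennreal_1)
      then show ?thesis using True t by (simp add: indicator_def)
    qed simp
  qed
  also have "\<dots> = (\<integral>\<^sup>+z. ennreal (log_weight z ^ k) * indicator {T<..} (log_weight z) \<partial>poincare_measure)"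
    by (rule nn_integral_poincare_log_weight[symmetric]) simp
  also have "\<dots> \<le> (\<integral>\<^sup>+z. ennreal (log_weight z ^ k) * indicator {z. cmod z < d} z \<partial>poincare_measure)"
  proof (intro nn_integral_mono mult_left_mono)
    fix z assume "z \<in> space poincare_measure"
    then have "z \<noteq> 0" by auto
    then have "cmod z < d" if "log_weight z > T"
      using that \<open>0 < d\<close> by (auto simp: log_weight_eq T_def)
    then show "indicator {T<..} (log_weight z) \<le> (indicator {z. cmod z < d} z :: ennreal)"
      by (auto simp: indicator_def)
  qed simp
  finally show ?thesis
    by (simp add: top.extremum_unique)
qed

subsection \<open>Means over circles\<close>

text \<open>A Bochner integral over a probability space of rotations, rather than a contour
  integral: it can be exchanged with integration over \<open>poincare_measure\<close>, fixes
  constants, and serves real and complex integrands alike.\<close>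

definition circle_mean :: "(complex \<Rightarrow> 'a::{banach, second_countable_topology}) \<Rightarrow> complex \<Rightarrow> 'a" where
  "circle_mean h z = (LINT s|restrict_space lborel {0..1}. h (z * cis (2 * pi * s)))"

lemma finite_measure_unit_interval: "finite_measure (restrict_space lborel {0..1::real})"
  by (intro finite_measureI) (simp add: emeasure_restrict_space space_restrict_space)

lemma measure_unit_interval: "measure (restrict_space lborel {0..1::real}) {0..1} = 1"
  by (simp add: measure_restrict_space)

lemma circle_point_in_punctured_disk: "z \<in> punctured_disk \<Longrightarrow> z * cis t \<in> punctured_disk"
  by (simp add: mult_unimodular_in_punctured_disk_iff)

lemma continuous_on_circle:
  assumes "continuous_on punctured_disk h" "z \<in> punctured_disk"
  shows "continuous_on S (\<lambda>s. h (z * cis (2 * pi * s)))"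
  by (rule continuous_on_compose2[OF assms(1)])
    (auto intro!: continuous_intros circle_point_in_punctured_disk assms(2))

lemma integrable_circle:
  fixes h :: "complex \<Rightarrow> 'a::{banach, second_countable_topology}"
  assumes "continuous_on punctured_disk h" "z \<in> punctured_disk"
  shows "integrable (restrict_space lborel {0..1}) (\<lambda>s. h (z * cis (2 * pi * s)))"
proof -
  have "set_integrable lborel {0..1} (\<lambda>s. h (z * cis (2 * pi * s)))"
    by (intro borel_integrable_atLeastAtMost' continuous_on_circle assms)
  then show ?thesis
    unfolding set_integrable_def by (subst integrable_restrict_space) auto
qed

lemma circle_mean_eq_integral:
  fixes h :: "complex \<Rightarrow> 'a::euclidean_space"
  assumes "continuous_on punctured_disk h" "z \<in> punctured_disk"
  shows "circle_mean h z = integral {0..1} (\<lambda>s. h (z * cis (2 * pi * s)))"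
proof -
  have "set_integrable lborel {0..1} (\<lambda>s. h (z * cis (2 * pi * s)))"
    by (intro borel_integrable_atLeastAtMost' continuous_on_circle assms)
  then have "(LINT s:{0..1}|lborel. h (z * cis (2 * pi * s))) = integral {0..1} (\<lambda>s. h (z * cis (2 * pi * s)))"
    by (rule set_borel_integral_eq_integral)
  then show ?thesis
    unfolding circle_mean_def set_lebesgue_integral_def by (subst integral_restrict_space) auto
qed

lemma circle_mean_cong:
  assumes "\<And>w. cmod w = cmod z \<Longrightarrow> g w = h w"
  shows "circle_mean g z = circle_mean h z"
  unfolding circle_mean_def by (intro Bochner_Integration.integral_cong refl assms) (simp add: norm_mult)

lemma circle_mean_mult_radial:
  fixes h :: "complex \<Rightarrow> 'a::{real_normed_field, banach, second_countable_topology}"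
  shows "circle_mean (\<lambda>w. c (cmod w) * h w) z = c (cmod z) * circle_mean h z"
  by (simp add: circle_mean_def norm_mult)

lemma circle_mean_cmult:
  fixes h :: "complex \<Rightarrow> 'a::{real_normed_field, banach, second_countable_topology}"
  shows "circle_mean (\<lambda>w. c * h w) z = c * circle_mean h z"
  by (rule circle_mean_mult_radial)

lemma circle_mean_const [simp]:
  "circle_mean (\<lambda>_. c) z = c"
  by (simp add: circle_mean_def space_restrict_space measure_unit_interval)

lemma circle_mean_diff:
  fixes h :: "complex \<Rightarrow> 'a::{banach, second_countable_topology}"
  assumes "continuous_on punctured_disk g" "continuous_on punctured_disk h" "z \<in> punctured_disk"
  shows "circle_mean (\<lambda>w. g w - h w) z = circle_mean g z - circle_mean h z"
  unfolding circle_mean_def by (intro Bochner_Integration.integral_diff integrable_circle assms)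

lemma circle_mean_add:
  fixes h :: "complex \<Rightarrow> 'a::{banach, second_countable_topology}"
  assumes "continuous_on punctured_disk g" "continuous_on punctured_disk h" "z \<in> punctured_disk"
  shows "circle_mean (\<lambda>w. g w + h w) z = circle_mean g z + circle_mean h z"
  unfolding circle_mean_def by (intro Bochner_Integration.integral_add integrable_circle assms)

lemma circle_mean_of_real: "circle_mean (\<lambda>w. complex_of_real (h w)) z = of_real (circle_mean h z)"
  by (simp add: circle_mean_def)

lemma norm_circle_mean_le:
  fixes h :: "complex \<Rightarrow> 'a::{banach, second_countable_topology}"
  assumes "continuous_on punctured_disk g" "z \<in> punctured_disk"
  assumes "\<And>w. cmod w = cmod z \<Longrightarrow> norm (h w) \<le> g w"
  shows "norm (circle_mean h z) \<le> circle_mean g z"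
proof -
  have b: "norm (h (z * cis t)) \<le> g (z * cis t)" for t
    by (intro assms(3)) (simp add: norm_mult)
  have "norm (circle_mean h z) \<le> circle_mean (\<lambda>w. norm (h w)) z"
    unfolding circle_mean_def by (rule integral_norm_bound)
  also have "\<dots> \<le> circle_mean g z"
    unfolding circle_mean_def
    by (intro integral_mono' integrable_circle assms(1,2) b order_trans[OF norm_ge_zero b])
  finally show ?thesis .
qed

lemma circle_mean_sums:
  fixes h :: "nat \<Rightarrow> complex \<Rightarrow> 'a::{banach, second_countable_topology}"
  assumes cont: "\<And>n. continuous_on punctured_disk (h n)" and z: "z \<in> punctured_disk"
    and bound: "\<And>n w. cmod w = cmod z \<Longrightarrow> norm (h n w) \<le> B n"
    and B: "summable B"
  shows "(\<lambda>n. circle_mean (h n) z) sums circle_mean (\<lambda>w. \<Sum>n. h n w) z"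
  unfolding circle_mean_def
proof (rule sums_integral)
  let ?p = "\<lambda>s. z * cis (2 * pi * s)"
  have nm: "cmod (?p s) = cmod z" for s by (simp add: norm_mult)
  show "integrable (restrict_space lborel {0..1}) (\<lambda>s. h n (?p s))" for n
    by (intro integrable_circle cont z)
  have sm: "summable (\<lambda>n. norm (h n (?p s)))" for s
    by (rule summable_comparison_test[OF _ B]) (use bound[OF nm] in auto)
  then show "AE s in restrict_space lborel {0..1}. summable (\<lambda>n. norm (h n (?p s)))" by simp
  show "summable (\<lambda>n. LINT s|restrict_space lborel {0..1}. norm (h n (?p s)))"
  proof (rule summable_comparison_test[OF _ B], intro exI allI impI)
    fix n
    have "norm (LINT s|restrict_space lborel {0..1}. norm (h n (?p s))) =
        norm (circle_mean (\<lambda>w. norm (h n w)) z)"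
      by (simp add: circle_mean_def)
    also have "\<dots> \<le> circle_mean (\<lambda>_. B n) z"
      using bound by (intro norm_circle_mean_le z) auto
    finally show "norm (LINT s|restrict_space lborel {0..1}. norm (h n (?p s))) \<le> B n" by simp
  qed
qed

text \<open>The circle mean is holomorphic in its base point, and its derivative is the mean of a
  tangential derivative, which vanishes by periodicity.\<close>
lemma circle_mean_holomorphic_constant:
  assumes h: "h holomorphic_on punctured_disk" and "z \<in> punctured_disk" "w \<in> punctured_disk"
  shows "circle_mean h z = circle_mean h w"
proof -
  have cont: "continuous_on punctured_disk h"
    using h by (rule holomorphic_on_imp_continuous_on)
  have dh: "(h has_field_derivative deriv h x) (at x)" if "x \<in> punctured_disk" for x
    using that h open_punctured_disk by (auto intro!: holomorphic_derivI)
  have cont_dh: "continuous_on punctured_disk (deriv h)"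
    by (intro holomorphic_on_imp_continuous_on holomorphic_deriv h open_punctured_disk)
  have deriv0: "(circle_mean h has_field_derivative 0) (at x)" if x: "x \<in> punctured_disk" for x
  proof -
    obtain e where e: "e > 0" "ball x e \<subseteq> punctured_disk"
      using open_punctured_disk x openE by blast
    let ?p = "\<lambda>x s. x * cis (2 * pi * s)"
    let ?d = "\<lambda>x s. deriv h (?p x s) * cis (2 * pi * s)"
    have "((\<lambda>y. integral (cbox 0 1) (\<lambda>s. h (?p y s))) has_field_derivative integral (cbox 0 1) (?d x))
        (at x within ball x e)"
    proof (rule leibniz_rule_field_derivative)
      fix y :: complex and s :: real
      assume y: "y \<in> ball x e"
      have "(h has_field_derivative deriv h (?p y s)) (at (?p y s))"
        using y e by (intro dh circle_point_in_punctured_disk) auto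
      moreover have "((\<lambda>y. ?p y s) has_field_derivative cis (2 * pi * s)) (at y within ball x e)"
        by (auto intro!: derivative_eq_intros)
      ultimately show "((\<lambda>y. h (?p y s)) has_field_derivative ?d y s) (at y within ball x e)"
        by (rule DERIV_chain2)
      show "(\<lambda>s. h (?p y s)) integrable_on cbox 0 1"
        using y e by (intro integrable_continuous continuous_on_circle cont) auto
    next
      show "continuous_on (ball x e \<times> cbox 0 1) (\<lambda>(x, s). ?d x s)"
        unfolding split_beta
        by (intro continuous_intros continuous_on_compose2[OF cont_dh])
          (use e in \<open>auto intro!: circle_point_in_punctured_disk\<close>)
    qed (use e in auto)
    moreover have "integral (cbox 0 1) (?d x) = 0"
    proof -
      have "((\<lambda>s. (2 * pi * \<i> * x) * ?d x s) has_integral h (?p x 1) - h (?p x 0)) {0..1}"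
      proof (rule fundamental_theorem_of_calculus)
        fix s :: real
        have 1: "(?p x has_vector_derivative (2 * pi * \<i> * x) * cis (2 * pi * s)) (at s within {0..1})"
        proof -
          have "((\<lambda>u. x * exp (2 * pi * \<i> * u)) has_field_derivative
              (2 * pi * \<i> * x) * exp (2 * pi * \<i> * of_real s)) (at (of_real s))"
            by (auto intro!: derivative_eq_intros)
          from has_vector_derivative_real_field[OF this] show ?thesis
            by (simp add: cis_conv_exp mult_ac)
        qed
        have "((h \<circ> ?p x) has_vector_derivative
            ((2 * pi * \<i> * x) * cis (2 * pi * s)) * deriv h (?p x s)) (at s within {0..1})"
          using x by (intro field_vector_diff_chain_within[OF 1] DERIV_subset[OF dh] circle_point_in_punctured_disk) auto
        then show "((\<lambda>s. h (?p x s)) has_vector_derivative (2 * pi * \<i> * x) * ?d x s) (at s within {0..1})"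
          by (simp add: o_def mult_ac)
      qed simp
      then have "(2 * pi * \<i> * x) * integral {0..1} (?d x) = h (?p x 1) - h (?p x 0)"
        by (subst integral_mult_right[symmetric]) (rule integral_unique)
      moreover have "x \<noteq> 0" using x by auto
      ultimately show ?thesis by simp
    qed
    moreover have "at x within ball x e = at x"
      using e by (intro at_within_open) auto
    ultimately have "((\<lambda>y. integral (cbox 0 1) (\<lambda>s. h (?p y s))) has_field_derivative 0) (at x)"
      by (simp only:)
    then show ?thesis
    proof (rule has_field_derivative_transform_within_open)
      show "integral (cbox 0 1) (\<lambda>s. h (?p y s)) = circle_mean h y" if "y \<in> ball x e" for y
        using that e by (subst circle_mean_eq_integral[OF cont]) auto
    qed (use e in auto)
  qed
  have "circle_mean h constant_on punctured_disk"
  proof -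
    have "continuous_on punctured_disk (circle_mean h)"
      using deriv0 by (intro continuous_at_imp_continuous_on ballI DERIV_isCont)
    then obtain c where "\<And>x. x \<in> punctured_disk \<Longrightarrow> circle_mean h x = c"
      using DERIV_zero_connected_constant[OF connected_punctured_disk open_punctured_disk finite.emptyI,
          of "circle_mean h"] deriv0 by auto
    then show ?thesis
      unfolding constant_on_def by blast
  qed
  then show ?thesis
    using assms unfolding constant_on_def by auto
qed

lemma circle_map_measurable:
  "(\<lambda>(s, z). z * cis (2 * pi * s)) \<in>
     restrict_space lborel {0..1} \<Otimes>\<^sub>M poincare_measure \<rightarrow>\<^sub>M poincare_measure"
proof -
  have 1 [measurable]: "(\<lambda>s. cis (2 * pi * s)) \<in> borel_measurable (restrict_space lborel {0..1})"
    by (intro measurable_restrict_space1) (auto intro!: borel_measurable_continuous_onI continuous_intros)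
  have 2 [measurable]: "(\<lambda>z. z) \<in> borel_measurable poincare_measure"
    by (intro borel_measurable_poincareI) simp
  have "(\<lambda>(s, z). z * cis (2 * pi * s)) \<in>
     restrict_space lborel {0..1} \<Otimes>\<^sub>M poincare_measure \<rightarrow>\<^sub>M restrict_space borel punctured_disk"
    by (intro measurable_restrict_space2)
      (auto simp: space_pair_measure circle_point_in_punctured_disk)
  then show ?thesis
    by (simp add: measurable_cong_sets[OF refl sets_poincare_measure])
qed

section \<open>Averaging integrals over rotations\<close>

text \<open>Every rotation preserves the measure, so the integral equals its average over all
  rotations; Tonelli moves the average inside.\<close>

lemma nn_integral_poincare_circle_mean:
  assumes cont: "continuous_on punctured_disk F" and nonneg: "\<And>z. z \<in> punctured_disk \<Longrightarrow> 0 \<le> F z"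
  shows "(\<integral>\<^sup>+z. ennreal (F z) \<partial>poincare_measure) = (\<integral>\<^sup>+z. ennreal (circle_mean F z) \<partial>poincare_measure)"
proof -
  let ?U = "restrict_space lborel {0..1::real}"
  interpret U: finite_measure ?U by (rule finite_measure_unit_interval)
  interpret P: sigma_finite_measure poincare_measure by (rule sigma_finite_poincare_measure)
  interpret UP: pair_sigma_finite ?U poincare_measure ..
  have F [measurable]: "F \<in> borel_measurable poincare_measure"
    using cont by (rule borel_measurable_poincare_continuous)
  have meas: "(\<lambda>(s, z). ennreal (F (z * cis (2 * pi * s)))) \<in> borel_measurable (?U \<Otimes>\<^sub>M poincare_measure)"
    using measurable_compose[OF circle_map_measurable F] by (simp add: split_beta)
  have "(\<integral>\<^sup>+s. (\<integral>\<^sup>+z. ennreal (F (z * cis (2 * pi * s))) \<partial>poincare_measure) \<partial>?U) =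
      (\<integral>\<^sup>+s. (\<integral>\<^sup>+z. ennreal (F z) \<partial>poincare_measure) \<partial>?U)"
  proof (rule nn_integral_cong)
    fix s :: real
    have "(\<integral>\<^sup>+z. ennreal (F (z * cis (2 * pi * s))) \<partial>poincare_measure) =
        (\<integral>\<^sup>+z. ennreal (F z) \<partial>distr poincare_measure poincare_measure (\<lambda>z. z * cis (2 * pi * s)))"
      by (subst nn_integral_distr) (auto intro!: mult_unimodular_measurable_poincare)
    then show "(\<integral>\<^sup>+z. ennreal (F (z * cis (2 * pi * s))) \<partial>poincare_measure) = (\<integral>\<^sup>+z. ennreal (F z) \<partial>poincare_measure)"
      by (simp add: distr_poincare_mult_unimodular)
  qed
  also have "\<dots> = (\<integral>\<^sup>+z. ennreal (F z) \<partial>poincare_measure)"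
    by (simp add: space_restrict_space emeasure_restrict_space)
  finally have "(\<integral>\<^sup>+z. ennreal (F z) \<partial>poincare_measure) =
      (\<integral>\<^sup>+s. (\<integral>\<^sup>+z. ennreal (F (z * cis (2 * pi * s))) \<partial>poincare_measure) \<partial>?U)" ..
  also have "\<dots> = (\<integral>\<^sup>+z. (\<integral>\<^sup>+s. ennreal (F (z * cis (2 * pi * s))) \<partial>?U) \<partial>poincare_measure)"
    by (rule UP.Fubini'[OF meas, symmetric])
  also have "\<dots> = (\<integral>\<^sup>+z. ennreal (circle_mean F z) \<partial>poincare_measure)"
    unfolding circle_mean_def
    by (intro nn_integral_cong nn_integral_eq_integral integrable_circle cont AE_I2 nonneg circle_point_in_punctured_disk) auto
  finally show ?thesis .
qed

lemma integral_poincare_circle_mean: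
  fixes F :: "complex \<Rightarrow> 'a::{banach, second_countable_topology}"
  assumes cont: "continuous_on punctured_disk F" and int: "integrable poincare_measure F"
  shows "(LINT z|poincare_measure. F z) = (LINT z|poincare_measure. circle_mean F z)"
proof -
  let ?U = "restrict_space lborel {0..1::real}"
  interpret U: finite_measure ?U by (rule finite_measure_unit_interval)
  interpret P: sigma_finite_measure poincare_measure by (rule sigma_finite_poincare_measure)
  interpret UP: pair_sigma_finite ?U poincare_measure ..
  have F [measurable]: "F \<in> borel_measurable poincare_measure"
    using cont by (rule borel_measurable_poincare_continuous)
  have meas: "(\<lambda>(s, z). F (z * cis (2 * pi * s))) \<in> borel_measurable (?U \<Otimes>\<^sub>M poincare_measure)"
    using measurable_compose[OF circle_map_measurable F] by (simp add: split_beta)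
  have rot: "(LINT z|poincare_measure. G (z * cis (2 * pi * s))) = (LINT z|poincare_measure. G z)"
    if [measurable]: "G \<in> borel_measurable poincare_measure" for G :: "complex \<Rightarrow> 'b::{banach, second_countable_topology}" and s
  proof -
    have "(LINT z|poincare_measure. G (z * cis (2 * pi * s))) =
        (LINT z|distr poincare_measure poincare_measure (\<lambda>z. z * cis (2 * pi * s)). G z)"
      by (subst integral_distr) (auto intro!: mult_unimodular_measurable_poincare)
    then show ?thesis by (simp add: distr_poincare_mult_unimodular)
  qed
  have rot_int: "integrable poincare_measure (\<lambda>z. F (z * cis (2 * pi * s)))" for s
    using int integrable_distr_eq[OF mult_unimodular_measurable_poincare F, of "cis (2 * pi * s)"]
    by (simp add: distr_poincare_mult_unimodular)
  \<comment> \<open>By \<open>rot\<close> the inner integral of the norm does not depend on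
    \<open>s\<close>, so it is integrable over the unit interval.\<close>
  have pint: "integrable (?U \<Otimes>\<^sub>M poincare_measure) (\<lambda>(s, z). F (z * cis (2 * pi * s)))"
  proof (rule UP.Fubini_integrable[OF meas])
    show "integrable ?U (\<lambda>s. LINT z|poincare_measure. norm (case (s, z) of (s, z) \<Rightarrow> F (z * cis (2 * pi * s))))"
      using rot[of "\<lambda>z. norm (F z)"] by simp
  qed (use rot_int in auto)
  have "(LINT z|poincare_measure. F z) =
      (LINT s|?U. (LINT z|poincare_measure. F (z * cis (2 * pi * s))))"
    by (simp add: rot space_restrict_space measure_unit_interval)
  also have "\<dots> = (LINT z|poincare_measure. (LINT s|?U. F (z * cis (2 * pi * s))))"
    by (rule UP.Fubini_integral[OF pint, symmetric])
  finally show "(LINT z|poincare_measure. F z) = (LINT z|poincare_measure. circle_mean F z)"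
    by (simp add: circle_mean_def)
qed

subsection \<open>Fourier coefficients\<close>

lemma circle_bounded:
  fixes h :: "complex \<Rightarrow> 'a::real_normed_vector"
  assumes "continuous_on punctured_disk h" "z \<in> punctured_disk"
  obtains B where "\<And>w. cmod w = cmod z \<Longrightarrow> norm (h w) \<le> B"
proof -
  have "sphere 0 (cmod z) \<subseteq> punctured_disk"
    using assms(2) by (auto simp: punctured_disk_def)
  then have "compact (h ` sphere 0 (cmod z))"
    using assms(1) by (intro compact_continuous_image continuous_on_subset[OF assms(1)]) auto
  then obtain B where "\<forall>x\<in>h ` sphere 0 (cmod z). norm x \<le> B"
    using compact_imp_bounded bounded_iff by metis
  then show ?thesis
    by (intro that[of B]) auto
qed

lemma circle_mean_log_weight:
  fixes h :: "complex \<Rightarrow> 'a::{real_normed_field, banach, second_countable_topology}"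
  shows "circle_mean (\<lambda>w. h w * of_real (log_weight w ^ k)) z =
    circle_mean h z * of_real (log_weight z ^ k)"
  using circle_mean_mult_radial[of "\<lambda>r. of_real (ln (1 / r\<^sup>2) ^ k)" h z]
  by (simp add: log_weight_def mult.commute)

text \<open>Dividing by \<open>w ^ n\<close>, instead of multiplying by \<open>cnj (w ^ n)\<close>,
  keeps the integrand holomorphic. For holomorphic \<open>f\<close> the result is then the Laurent
  coefficient, and the radius 1/2 is just one admissible choice.\<close>

definition fourier_coeff :: "(complex \<Rightarrow> complex) \<Rightarrow> nat \<Rightarrow> complex" where
  "fourier_coeff f n = circle_mean (\<lambda>w. f w / w ^ n) (1/2)"

lemma fourier_coeff_eq:
  assumes "f holomorphic_on punctured_disk" "z \<in> punctured_disk"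
  shows "circle_mean (\<lambda>w. f w / w ^ n) z = fourier_coeff f n"
  unfolding fourier_coeff_def
proof (rule circle_mean_holomorphic_constant)
  show "(\<lambda>w. f w / w ^ n) holomorphic_on punctured_disk"
    using assms(1) by (intro holomorphic_intros) auto
qed (use assms in \<open>auto simp: punctured_disk_def norm_divide\<close>)

text \<open>By homogeneity the mean scales like z^(a-n), yet it must agree at the radii 1/2 and 1/4.
  For a \<noteq> n this forces it to vanish, without computing an integral.\<close>

lemma fourier_coeff_power: "fourier_coeff (\<lambda>w. w ^ a) n = (if a = n then 1 else 0)"
proof -
  have eq: "circle_mean (\<lambda>w::complex. w ^ a / w ^ n) z = z ^ a / z ^ n * circle_mean (\<lambda>w. w ^ a / w ^ n) 1" for z
  proof -
    have "(z * c) ^ a / (z * c) ^ n = z ^ a / z ^ n * ((1 * c) ^ a / (1 * c) ^ n)" for c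
      by (simp add: power_mult_distrib)
    then show ?thesis
      by (simp only: circle_mean_def integral_mult_right_zero)
  qed
  \<comment> \<open>The point 1 lies outside the punctured disk; this is harmless, since
    \<open>eq\<close> is pure homogeneity and independence of the radius is invoked only at 1/2 and
    1/4.\<close>
  define I :: complex where "I = circle_mean (\<lambda>w. w ^ a / w ^ n) 1"
  have "(1/2 :: complex) \<in> punctured_disk" "(1/4 :: complex) \<in> punctured_disk"
    by (auto simp: punctured_disk_def norm_divide)
  then have "circle_mean (\<lambda>w::complex. w ^ a / w ^ n) (1/2) = circle_mean (\<lambda>w. w ^ a / w ^ n) (1/4)"
    by (intro circle_mean_holomorphic_constant holomorphic_intros) auto
  then have I: "(1/2) ^ a / (1/2) ^ n * I = (1/4) ^ a / (1/4) ^ n * I"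
    unfolding eq[of "1/2"] eq[of "1/4"] I_def .
  show ?thesis
  proof (cases "a = n")
    case True
    have "fourier_coeff (\<lambda>w. w ^ a) n = circle_mean (\<lambda>_. 1) (1/2)"
      unfolding fourier_coeff_def True
      by (rule circle_mean_cong) (auto simp: norm_divide)
    then show ?thesis using True by simp
  next
    case False
    have "I = 0"
    proof (rule ccontr)
      assume "I \<noteq> 0"
      have "(1/2::complex) ^ a / (1/2) ^ n = (1/4) ^ a / (1/4) ^ n"
        using I by (simp only: mult_right_cancel[OF \<open>I \<noteq> 0\<close>])
      then have "(4::complex) ^ a * 2 ^ n = 2 ^ a * 4 ^ n"
        by (simp add: power_divide field_simps)
      moreover have "(4::complex) = 2 ^ 2" by simp
      ultimately have "(2::complex) ^ (2 * a + n) = 2 ^ (a + 2 * n)"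
        by (simp only: power_add power_mult)
      then have "cmod (2 ^ (2 * a + n)) = cmod (2 ^ (a + 2 * n))" by simp
      then have "(2::real) ^ (2 * a + n) = 2 ^ (a + 2 * n)" by (simp add: norm_power)
      then show False using False by (simp add: power_inject_exp)
    qed
    then show ?thesis
      using False eq[of "1/2"] by (simp add: fourier_coeff_def I_def)
  qed
qed

lemma bergman_spaceD:
  assumes "f \<in> bergman_space k"
  shows "f holomorphic_on punctured_disk" "continuous_on punctured_disk f"
    "integrable poincare_measure (\<lambda>z. (cmod (f z))\<^sup>2 * log_weight z ^ k)"
  using assms by (auto simp: bergman_space_def holomorphic_on_imp_continuous_on)

lemma continuous_on_weighted_square:
  "continuous_on punctured_disk f \<Longrightarrow> continuous_on punctured_disk (\<lambda>z. (cmod (f z))\<^sup>2 * log_weight z ^ k)"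
  by (intro continuous_intros continuous_on_log_weight)

lemma nn_integral_weighted_square:
  assumes "continuous_on punctured_disk f"
  shows "(\<integral>\<^sup>+z. ennreal ((cmod (f z))\<^sup>2 * log_weight z ^ k) \<partial>poincare_measure) =
    (\<integral>\<^sup>+z. ennreal (circle_mean (\<lambda>w. (cmod (f w))\<^sup>2) z * log_weight z ^ k) \<partial>poincare_measure)"
proof -
  have "(\<integral>\<^sup>+z. ennreal ((cmod (f z))\<^sup>2 * log_weight z ^ k) \<partial>poincare_measure) =
    (\<integral>\<^sup>+z. ennreal (circle_mean (\<lambda>w. (cmod (f w))\<^sup>2 * log_weight w ^ k) z) \<partial>poincare_measure)"
    by (intro nn_integral_poincare_circle_mean continuous_on_weighted_square assms)
      (simp add: log_weight_nonneg)
  then show ?thesis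
    using circle_mean_log_weight[of "\<lambda>w. (cmod (f w))\<^sup>2" k] by simp
qed

text \<open>The weight \<open>log_weight ^ k\<close> has infinite integral near the puncture.\<close>
lemma circle_mean_square_small:
  assumes f: "f \<in> bergman_space k" and k: "k \<ge> 2" and e: "0 < e" and d: "0 < d"
  shows "\<exists>z\<in>punctured_disk. cmod z < d \<and> circle_mean (\<lambda>w. (cmod (f w))\<^sup>2) z < e"
proof (rule ccontr)
  assume "\<not> ?thesis"
  then have ge: "e \<le> circle_mean (\<lambda>w. (cmod (f w))\<^sup>2) z" if "z \<in> punctured_disk" "cmod z < d" for z
    using that by (meson not_le_imp_less)
  have [measurable]: "(\<lambda>z. log_weight z ^ k) \<in> borel_measurable poincare_measure"
      "(\<lambda>z. indicator {z. cmod z < d} z :: ennreal) \<in> borel_measurable poincare_measure"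
    by (intro borel_measurable_poincareI; measurable)+
  have "\<infinity> = ennreal e * (\<integral>\<^sup>+z. ennreal (log_weight z ^ k) * indicator {z. cmod z < d} z \<partial>poincare_measure)"
    using e by (simp add: nn_integral_poincare_near_0[OF d k] ennreal_mult_top)
  also have "\<dots> = (\<integral>\<^sup>+z. ennreal e * (ennreal (log_weight z ^ k) * indicator {z. cmod z < d} z) \<partial>poincare_measure)"
    by (intro nn_integral_cmult[symmetric]) measurable
  also have "\<dots> \<le> (\<integral>\<^sup>+z. ennreal (circle_mean (\<lambda>w. (cmod (f w))\<^sup>2) z * log_weight z ^ k) \<partial>poincare_measure)"
  proof (rule nn_integral_mono)
    fix z assume "z \<in> space poincare_measure"
    then have z: "z \<in> punctured_disk" by simp
    show "ennreal e * (ennreal (log_weight z ^ k) * indicator {z. cmod z < d} z) \<le>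
        ennreal (circle_mean (\<lambda>w. (cmod (f w))\<^sup>2) z * log_weight z ^ k)"
    proof (cases "cmod z < d")
      case True
      have "e * log_weight z ^ k \<le> circle_mean (\<lambda>w. (cmod (f w))\<^sup>2) z * log_weight z ^ k"
        using ge[OF z True] log_weight_nonneg[OF z] by (intro mult_right_mono) auto
      then show ?thesis
        using True e log_weight_nonneg[OF z] by (simp add: ennreal_leI flip: ennreal_mult)
    qed simp
  qed
  also have "\<dots> = (\<integral>\<^sup>+z. ennreal ((cmod (f z))\<^sup>2 * log_weight z ^ k) \<partial>poincare_measure)"
    by (intro nn_integral_weighted_square[symmetric] bergman_spaceD(2)[OF f])
  also have "\<dots> < \<infinity>"
  proof -
    have "(\<integral>\<^sup>+z. ennreal ((cmod (f z))\<^sup>2 * log_weight z ^ k) \<partial>poincare_measure) =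
        ennreal (LINT z|poincare_measure. (cmod (f z))\<^sup>2 * log_weight z ^ k)"
      by (intro nn_integral_eq_integral bergman_spaceD(3)[OF f] AE_I2) (simp add: log_weight_nonneg)
    then show ?thesis by simp
  qed
  finally show False by simp
qed

text \<open>The mean of \<open>f\<close> is the same on all circles, and on suitable circles the
  mean square is below d^2. The pointwise bound |f| \<le> d + |f|^2 / d, used in place of
  Cauchy-Schwarz, then bounds the mean by 2 d.\<close>

lemma fourier_coeff_0:
  assumes f: "f \<in> bergman_space k" and k: "k \<ge> 2"
  shows "fourier_coeff f 0 = 0"
proof -
  note hol = bergman_spaceD(1)[OF f] and cont = bergman_spaceD(2)[OF f]
  have "cmod (fourier_coeff f 0) \<le> 0 + e" if e: "e > 0" for e :: real
  proof -
    define d where "d = e / 2"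
    have d: "d > 0" using e by (simp add: d_def)
    obtain z where z: "z \<in> punctured_disk" and small: "circle_mean (\<lambda>w. (cmod (f w))\<^sup>2) z < d\<^sup>2"
      using circle_mean_square_small[OF f k, of "d\<^sup>2" 1] d by auto
    have "fourier_coeff f 0 = circle_mean f z"
      using fourier_coeff_eq[OF hol z, of 0] by simp
    also have "cmod \<dots> \<le> circle_mean (\<lambda>w. d + (1 / d) * (cmod (f w))\<^sup>2) z"
    proof (rule norm_circle_mean_le[OF _ z])
      show "cmod (f w) \<le> d + (1 / d) * (cmod (f w))\<^sup>2" for w
      proof (cases "cmod (f w) \<le> d")
        case True
        then show ?thesis using d by (intro order_trans[OF True]) simp
      next
        case False
        then have "d * cmod (f w) \<le> (cmod (f w))\<^sup>2" by (simp add: power2_eq_square mult_right_mono)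
        then have "cmod (f w) \<le> (1 / d) * (cmod (f w))\<^sup>2" using d by (simp add: field_simps)
        then show ?thesis using d by simp
      qed
    qed (intro continuous_intros cont)
    also have "\<dots> = d + (1 / d) * circle_mean (\<lambda>w. (cmod (f w))\<^sup>2) z"
    proof -
      have "continuous_on punctured_disk (\<lambda>w. (1 / d) * (cmod (f w))\<^sup>2)"
        by (intro continuous_intros cont) (use d in simp)
      then show ?thesis
        by (simp only: circle_mean_add[OF continuous_on_const _ z] circle_mean_cmult circle_mean_const)
    qed
    also have "\<dots> \<le> d + (1 / d) * d\<^sup>2"
      using small d by (intro add_left_mono mult_left_mono) auto
    also have "\<dots> = e"
      using d by (simp add: d_def power2_eq_square)
    finally show ?thesis by simp
  qed
  then have "cmod (fourier_coeff f 0) \<le> 0" by (rule field_le_epsilon)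
  then show ?thesis by simp
qed

text \<open>The circle means of \<open>w (f w - f z) / (w - z)\<close> do not depend on the radius. They tend to 0 at the
  puncture, and for radii larger than \<open>cmod z\<close> they expand into a geometric series.\<close>
lemma fourier_coeff_sums:
  assumes f: "f \<in> bergman_space k" and k: "k \<ge> 2" and z: "z \<in> punctured_disk"
  shows "(\<lambda>n. fourier_coeff f n * z ^ n) sums f z"
proof -
  note hol = bergman_spaceD(1)[OF f] and cont = bergman_spaceD(2)[OF f]
  have z0: "z \<noteq> 0" and z1: "cmod z < 1" using z by (auto simp: punctured_disk_def)
  \<comment> \<open>The derivative removes the singularity at \<open>z\<close>. The factor
    \<open>w\<close> turns the kernel into w / (w - z), which is the geometric series in z / w for
    |w| > |z|.\<close>
  define g where "g = (\<lambda>w. w * (if w = z then deriv f z else (f w - f z) / (w - z)))"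
  have g: "g holomorphic_on punctured_disk"
    unfolding g_def by (intro holomorphic_intros pole_lemma_open hol open_punctured_disk)
  have cont_g: "continuous_on punctured_disk g"
    using g by (rule holomorphic_on_imp_continuous_on)
  \<comment> \<open>Any radius strictly between \<open>cmod z\<close> and 1 serves here; the
    midpoint is taken.\<close>
  define W :: complex where "W = of_real ((1 + cmod z) / 2)"
  have W: "cmod W = (1 + cmod z) / 2" unfolding W_def norm_of_real by simp
  have W_pd: "W \<in> punctured_disk" using z1 unfolding punctured_disk_def mem_Collect_eq W by (simp add: add_pos_nonneg)
  have zW: "cmod z < cmod W" using z1 by (simp add: W)
  \<comment> \<open>On a circle of radius |v| < |z| / 2 the denominator is at least |z| / 2, and the
    mean of |f w - f z| is at most (1 + |f z|) + 1 once the mean square is below 1. Hence the mean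
    of \<open>g\<close> is at most |v| C.\<close>
  define C where "C = (2 + cmod (f z)) * 2 / cmod z"
  have C: "C > 0" using z0 by (auto simp: C_def intro!: divide_pos_pos mult_pos_pos add_pos_nonneg)
  have "cmod (circle_mean g W) \<le> 0 + e" if e: "e > 0" for e :: real
  proof -
    \<comment> \<open>The first bound makes |v| C at most \<open>e\<close>; the second keeps the
      circle away from \<open>z\<close>.\<close>
    define d where "d = min (e / C) (cmod z / 2)"
    have d: "d > 0" "d \<le> e / C" "d \<le> cmod z / 2"
      unfolding d_def using e C z0 by (simp_all only: min.cobounded1 min.cobounded2) simp
    obtain v where v: "v \<in> punctured_disk" "cmod v < d" and small: "circle_mean (\<lambda>w. (cmod (f w))\<^sup>2) v < 1"
      using circle_mean_square_small[OF f k, of 1 d] d by auto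
    have "circle_mean g W = circle_mean g v"
      by (rule circle_mean_holomorphic_constant[OF g W_pd v(1)])
    also have "cmod \<dots> \<le> circle_mean (\<lambda>w. cmod v * 2 / cmod z * ((1 + cmod (f z)) + (cmod (f w))\<^sup>2)) v"
    proof (rule norm_circle_mean_le[OF _ v(1)])
      fix w assume w: "cmod w = cmod v"
      then have wz: "cmod w < cmod z / 2" using v d by linarith
      then have ne: "w \<noteq> z" using z0 by auto
      have "cmod z / 2 \<le> cmod z - cmod w" using wz by linarith
      also have "\<dots> \<le> cmod (w - z)"
        by (metis norm_minus_commute norm_triangle_ineq2)
      finally have den: "cmod z / 2 \<le> cmod (w - z)" .
      have "cmod (f w - f z) \<le> cmod (f w) + cmod (f z)" by (rule norm_triangle_ineq4)
      also have "cmod (f w) \<le> 1 + (cmod (f w))\<^sup>2"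
      proof -
        have "0 \<le> (cmod (f w) - 1)\<^sup>2" by simp
        then have "2 * cmod (f w) \<le> 1 + (cmod (f w))\<^sup>2" by (simp add: power2_eq_square algebra_simps)
        then show ?thesis using norm_ge_zero[of "f w"] by linarith
      qed
      finally have num: "cmod (f w - f z) \<le> (1 + cmod (f z)) + (cmod (f w))\<^sup>2" by simp
      have "cmod (g w) = cmod w * (cmod (f w - f z) / cmod (w - z))"
        using ne by (simp add: g_def norm_mult norm_divide)
      also have "\<dots> \<le> cmod w * (((1 + cmod (f z)) + (cmod (f w))\<^sup>2) / (cmod z / 2))"
        using num den z0 by (intro mult_left_mono frac_le) auto
      finally show "cmod (g w) \<le> cmod v * 2 / cmod z * ((1 + cmod (f z)) + (cmod (f w))\<^sup>2)"
        using w z0 by (simp add: field_simps)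
    qed (intro continuous_intros cont; use z0 in simp)
    also have "\<dots> = cmod v * 2 / cmod z * ((1 + cmod (f z)) + circle_mean (\<lambda>w. (cmod (f w))\<^sup>2) v)"
      by (subst circle_mean_cmult, subst circle_mean_add[OF _ _ v(1)]) (auto intro!: continuous_intros cont)
    also have "\<dots> \<le> cmod v * 2 / cmod z * ((1 + cmod (f z)) + 1)"
      using small by (intro mult_left_mono add_left_mono) auto
    also have "\<dots> = cmod v * C" by (simp add: C_def)
    also have "\<dots> \<le> (e / C) * C" using v d C by (intro mult_right_mono) auto
    also have "\<dots> = e" using C by simp
    finally show ?thesis by simp
  qed
  then have "cmod (circle_mean g W) \<le> 0" by (rule field_le_epsilon)
  then have g0: "circle_mean g W = 0" by simp
  \<comment> \<open>These are the terms of the geometric expansion of \<open>g\<close> on the circle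
    through \<open>W\<close>.\<close>
  define h where "h = (\<lambda>n w. (f w - f z) * (z ^ n / w ^ n))"
  have cont_h: "continuous_on punctured_disk (h n)" for n
    unfolding h_def by (intro continuous_intros cont) auto
  obtain B where B: "\<And>w. cmod w = cmod W \<Longrightarrow> norm (f w - f z) \<le> B"
    using circle_bounded[OF continuous_on_diff[OF cont continuous_on_const] W_pd] by blast
  have "(\<lambda>n. circle_mean (h n) W) sums circle_mean (\<lambda>w. \<Sum>n. h n w) W"
  proof (rule circle_mean_sums[OF cont_h W_pd])
    show "norm (h n w) \<le> B * (cmod z / cmod W) ^ n" if "cmod w = cmod W" for n w
    proof -
      have "norm (h n w) = norm (f w - f z) * (cmod z / cmod W) ^ n"
        using that by (simp add: h_def norm_mult norm_divide norm_power power_divide)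
      also have "\<dots> \<le> B * (cmod z / cmod W) ^ n"
        by (intro mult_right_mono B that) simp
      finally show ?thesis .
    qed
    have "cmod z / cmod W < 1" using zW z0 by (simp add: divide_less_eq_1)
    then show "summable (\<lambda>n. B * (cmod z / cmod W) ^ n)"
      by (intro summable_mult summable_geometric) simp
  qed
  also have "circle_mean (\<lambda>w. \<Sum>n. h n w) W = circle_mean g W"
  proof (rule circle_mean_cong)
    fix w assume w: "cmod w = cmod W"
    then have w0: "w \<noteq> 0" and ne: "w \<noteq> z" using W_pd zW by auto
    have "norm (z / w) < 1" using w zW by (simp add: norm_divide divide_less_eq_1)
    then have "(\<lambda>n. (z / w) ^ n) sums (1 / (1 - z / w))" by (rule geometric_sums)
    then have "(\<lambda>n. (f w - f z) * (z / w) ^ n) sums ((f w - f z) * (1 / (1 - z / w)))"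
      by (rule sums_mult)
    then have "(\<Sum>n. h n w) = (f w - f z) * (1 / (1 - z / w))"
      by (simp add: h_def power_divide sums_iff)
    also have "\<dots> = g w"
      using w0 ne by (simp add: g_def divide_simps)
    finally show "(\<Sum>n. h n w) = g w" .
  qed
  finally have 1: "(\<lambda>n. circle_mean (h n) W) sums 0" using g0 by simp
  \<comment> \<open>The constant \<open>f z\<close> has only a zeroth coefficient, so the vanishing
    total says that the power series minus \<open>f z\<close> is 0.\<close>
  have "circle_mean (h n) W = fourier_coeff f n * z ^ n - (if n = 0 then f z else 0)" for n
  proof -
    have "circle_mean (h n) W = circle_mean (\<lambda>w. z ^ n * (f w / w ^ n - f z * (w ^ 0 / w ^ n))) W"
      by (rule circle_mean_cong) (simp add: h_def algebra_simps diff_divide_distrib)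
    also have "\<dots> = z ^ n * (circle_mean (\<lambda>w. f w / w ^ n) W - f z * circle_mean (\<lambda>w. w ^ 0 / w ^ n) W)"
    proof -
      have 1: "continuous_on punctured_disk (\<lambda>w. f w / w ^ n)"
        by (intro continuous_intros cont) auto
      have 2: "continuous_on punctured_disk (\<lambda>w. f z * (w ^ 0 / w ^ n))"
        by (intro continuous_intros cont) auto
      show ?thesis
        by (simp only: circle_mean_cmult circle_mean_diff[OF 1 2 W_pd])
    qed
    also have "\<dots> = z ^ n * (fourier_coeff f n - f z * (if n = 0 then 1 else 0))"
      using fourier_coeff_eq[OF hol W_pd] fourier_coeff_eq[OF _ W_pd, of "\<lambda>w. w ^ 0" n] fourier_coeff_power[of 0 n]
      by auto
    finally show ?thesis by (auto simp: algebra_simps)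
  qed
  with 1 have "(\<lambda>n. fourier_coeff f n * z ^ n - (if n = 0 then f z else 0)) sums 0" by simp
  moreover have "(\<lambda>n. if n = 0 then f z else 0) sums f z"
    using sums_If_finite_set[of "{0::nat}" "\<lambda>_. f z"] by simp
  ultimately have "(\<lambda>n. (fourier_coeff f n * z ^ n - (if n = 0 then f z else 0)) + (if n = 0 then f z else 0)) sums (0 + f z)"
    by (rule sums_add)
  then show ?thesis by simp
qed

text \<open>The power series converges at a point of larger modulus still inside the disk, hence
  absolutely at \<open>z\<close>.\<close>

lemma summable_fourier_coeff:
  assumes f: "f \<in> bergman_space k" and k: "k \<ge> 2" and z: "z \<in> punctured_disk"
  shows "summable (\<lambda>n. cmod (fourier_coeff f n * z ^ n))"
proof -
  define W :: complex where "W = of_real ((1 + cmod z) / 2)"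
  have W: "cmod W = (1 + cmod z) / 2" unfolding W_def norm_of_real by simp
  have "W \<in> punctured_disk" "cmod z < cmod W"
    using z unfolding punctured_disk_def mem_Collect_eq W by (simp_all add: add_pos_nonneg)
  then show ?thesis
    using fourier_coeff_sums[OF f k] sums_summable powser_insidea by blast
qed

section \<open>Parseval on circles and the Bergman norm\<close>

text \<open>On the circle through \<open>z\<close> the function cnj (w^n) equals |z|^(2n) / w^n,
  which brings back the holomorphic form of the coefficient.\<close>

lemma circle_mean_mult_cnj_power:
  assumes hol: "f holomorphic_on punctured_disk" and z: "z \<in> punctured_disk"
  shows "circle_mean (\<lambda>w. f w * cnj (w ^ n)) z = fourier_coeff f n * of_real (cmod z ^ (2 * n))"
proof -
  have "circle_mean (\<lambda>w. f w * cnj (w ^ n)) z = circle_mean (\<lambda>w. of_real (cmod z ^ (2 * n)) * (f w / w ^ n)) z"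
  proof (rule circle_mean_cong)
    fix w assume w: "cmod w = cmod z"
    then have w0: "w \<noteq> 0" using z by auto
    have "w ^ n * cnj (w ^ n) = of_real (cmod z ^ (2 * n))"
      by (simp only: complex_norm_square[symmetric] norm_power w power_mult[symmetric] mult.commute[of 2] of_real_power)
    then show "f w * cnj (w ^ n) = of_real (cmod z ^ (2 * n)) * (f w / w ^ n)"
      using w0 by (simp add: field_simps)
  qed
  also have "\<dots> = of_real (cmod z ^ (2 * n)) * fourier_coeff f n"
    by (simp only: circle_mean_cmult fourier_coeff_eq[OF hol z])
  finally show ?thesis
    by (simp only: mult.commute)
qed

text \<open>Only the conjugate factor of \<open>f * cnj f\<close> is expanded. The other factor is
  bounded on the circle, so absolute convergence of the power series justifies integrating term by
  term.\<close>

lemma circle_mean_square_sums: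
  assumes f: "f \<in> bergman_space k" and k: "k \<ge> 2" and z: "z \<in> punctured_disk"
  shows "(\<lambda>n. (cmod (fourier_coeff f n))\<^sup>2 * cmod z ^ (2 * n)) sums circle_mean (\<lambda>w. (cmod (f w))\<^sup>2) z"
proof -
  note hol = bergman_spaceD(1)[OF f] and cont = bergman_spaceD(2)[OF f]
  define h where "h = (\<lambda>n w. cnj (fourier_coeff f n) * (f w * cnj (w ^ n)))"
  obtain B where B: "\<And>w. cmod w = cmod z \<Longrightarrow> norm (f w) \<le> B"
    using circle_bounded[OF cont z] by blast
  have "(\<lambda>n. circle_mean (h n) z) sums circle_mean (\<lambda>w. \<Sum>n. h n w) z"
  proof (rule circle_mean_sums[OF _ z])
    show "continuous_on punctured_disk (h n)" for n
      unfolding h_def by (intro continuous_intros cont)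
    show "norm (h n w) \<le> B * cmod (fourier_coeff f n * z ^ n)" if w: "cmod w = cmod z" for n w
    proof -
      have "norm (h n w) = cmod (f w) * cmod (fourier_coeff f n * z ^ n)"
        by (simp add: h_def norm_mult norm_power w)
      also have "\<dots> \<le> B * cmod (fourier_coeff f n * z ^ n)"
        by (intro mult_right_mono B w) simp
      finally show ?thesis .
    qed
    show "summable (\<lambda>n. B * cmod (fourier_coeff f n * z ^ n))"
      by (intro summable_mult summable_fourier_coeff[OF f k z])
  qed
  also have "circle_mean (\<lambda>w. \<Sum>n. h n w) z = circle_mean (\<lambda>w. of_real ((cmod (f w))\<^sup>2)) z"
  proof (rule circle_mean_cong)
    fix w assume "cmod w = cmod z"
    then have w: "w \<in> punctured_disk" using z unfolding punctured_disk_def mem_Collect_eq by (simp only:)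
    have "(\<lambda>n. f w * cnj (fourier_coeff f n * w ^ n)) sums (f w * cnj (f w))"
      by (intro sums_mult) (simp only: sums_cnj fourier_coeff_sums[OF f k w])
    then have "h n w = f w * cnj (fourier_coeff f n * w ^ n)" for n
      by (simp add: h_def)
    then have "(\<Sum>n. h n w) = f w * cnj (f w)"
      using \<open>_ sums (f w * cnj (f w))\<close> by (simp add: sums_iff)
    then show "(\<Sum>n. h n w) = of_real ((cmod (f w))\<^sup>2)"
      by (simp only: complex_norm_square)
  qed
  finally have 1: "(\<lambda>n. circle_mean (h n) z) sums of_real (circle_mean (\<lambda>w. (cmod (f w))\<^sup>2) z)"
    by (simp only: circle_mean_of_real)
  have "circle_mean (h n) z = of_real ((cmod (fourier_coeff f n))\<^sup>2 * cmod z ^ (2 * n))" for n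
    unfolding h_def circle_mean_cmult circle_mean_mult_cnj_power[OF hol z]
    by (simp only: of_real_mult complex_norm_square) (simp add: ac_simps)
  with 1 show ?thesis
    by (simp only: sums_of_real_iff)
qed

text \<open>For \<open>n = 0\<close> and \<open>k \<ge> 2\<close> division by zero gives 0, although the norm is infinite; the coefficient it
  multiplies vanishes as well.\<close>
definition monomial_norm2 :: "nat \<Rightarrow> nat \<Rightarrow> real" where
  "monomial_norm2 k n = 2 * pi * fact (k - 2) / real n ^ (k - 1)"

lemma monomial_norm2_nonneg: "0 \<le> monomial_norm2 k n"
  by (simp add: monomial_norm2_def)

lemma monomial_norm2_pos: "1 \<le> n \<Longrightarrow> 0 < monomial_norm2 k n"
  by (simp add: monomial_norm2_def)

text \<open>Averaging over circles replaces |f|^2 by its radial Parseval sum, whose nonnegative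
  terms may be integrated one by one. Hence the monomials exhaust the norm, which later yields
  density of their span.\<close>

lemma bergman_norm_sums:
  assumes f: "f \<in> bergman_space k" and k: "k \<ge> 2"
  shows "(\<lambda>n. (cmod (fourier_coeff f n))\<^sup>2 * monomial_norm2 k n) sums
    (LINT z|poincare_measure. (cmod (f z))\<^sup>2 * log_weight z ^ k)"
proof -
  note hol = bergman_spaceD(1)[OF f] and cont = bergman_spaceD(2)[OF f]
  let ?c = "\<lambda>n. (cmod (fourier_coeff f n))\<^sup>2"
  have meas [measurable]: "(\<lambda>z. log_weight z ^ k) \<in> borel_measurable poincare_measure"
      "(\<lambda>z. cmod z) \<in> borel_measurable poincare_measure"
    by (intro borel_measurable_poincareI; measurable)+
  have "ennreal (LINT z|poincare_measure. (cmod (f z))\<^sup>2 * log_weight z ^ k) =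
      (\<integral>\<^sup>+z. ennreal ((cmod (f z))\<^sup>2 * log_weight z ^ k) \<partial>poincare_measure)"
    by (intro nn_integral_eq_integral[symmetric] bergman_spaceD(3)[OF f] AE_I2) (simp add: log_weight_nonneg)
  also have "\<dots> = (\<integral>\<^sup>+z. ennreal (circle_mean (\<lambda>w. (cmod (f w))\<^sup>2) z * log_weight z ^ k) \<partial>poincare_measure)"
    by (rule nn_integral_weighted_square[OF cont])
  also have "\<dots> = (\<integral>\<^sup>+z. (\<Sum>n. ennreal (?c n * (cmod z ^ (2 * n) * log_weight z ^ k))) \<partial>poincare_measure)"
  proof (rule nn_integral_cong)
    fix z assume "z \<in> space poincare_measure"
    then have z: "z \<in> punctured_disk" by simp
    have "(\<lambda>n. ?c n * cmod z ^ (2 * n) * log_weight z ^ k) sums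
        (circle_mean (\<lambda>w. (cmod (f w))\<^sup>2) z * log_weight z ^ k)"
      by (intro sums_mult2 circle_mean_square_sums[OF f k z])
    then show "ennreal (circle_mean (\<lambda>w. (cmod (f w))\<^sup>2) z * log_weight z ^ k) =
        (\<Sum>n. ennreal (?c n * (cmod z ^ (2 * n) * log_weight z ^ k)))"
      using log_weight_nonneg[OF z]
      by (subst suminf_ennreal2) (auto simp: sums_iff mult.assoc)
  qed
  also have "\<dots> = (\<Sum>n. \<integral>\<^sup>+z. ennreal (?c n * (cmod z ^ (2 * n) * log_weight z ^ k)) \<partial>poincare_measure)"
    by (intro nn_integral_suminf) measurable
  also have "\<dots> = (\<Sum>n. ennreal (?c n * monomial_norm2 k n))"
  proof (rule suminf_cong)
    fix n
    show "(\<integral>\<^sup>+z. ennreal (?c n * (cmod z ^ (2 * n) * log_weight z ^ k)) \<partial>poincare_measure) =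
        ennreal (?c n * monomial_norm2 k n)"
    proof (cases "n = 0")
      case True
      then show ?thesis by (simp add: fourier_coeff_0[OF f k])
    next
      case False
      have "(\<integral>\<^sup>+z. ennreal (?c n * (cmod z ^ (2 * n) * log_weight z ^ k)) \<partial>poincare_measure) =
          (\<integral>\<^sup>+z. ennreal (?c n) * ennreal (cmod z ^ (2 * n) * log_weight z ^ k) \<partial>poincare_measure)"
        by (intro nn_integral_cong ennreal_mult) (simp_all add: log_weight_nonneg)
      also have "\<dots> = ennreal (?c n) * (\<integral>\<^sup>+z. ennreal (cmod z ^ (2 * n) * log_weight z ^ k) \<partial>poincare_measure)"
        by (intro nn_integral_cmult) measurable
      also have "\<dots> = ennreal (?c n * monomial_norm2 k n)"
        using False k by (subst nn_integral_poincare_monomial)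
          (auto simp: monomial_norm2_def simp flip: ennreal_mult)
      finally show ?thesis .
    qed
  qed
  finally have eq: "(\<Sum>n. ennreal (?c n * monomial_norm2 k n)) =
      ennreal (LINT z|poincare_measure. (cmod (f z))\<^sup>2 * log_weight z ^ k)" ..
  have I0: "0 \<le> (LINT z|poincare_measure. (cmod (f z))\<^sup>2 * log_weight z ^ k)"
    by (intro Bochner_Integration.integral_nonneg) (simp add: log_weight_nonneg)
  have nn: "0 \<le> ?c n * monomial_norm2 k n" for n
    by (simp add: monomial_norm2_nonneg)
  have "(\<lambda>n. ennreal (?c n * monomial_norm2 k n)) sums
      ennreal (LINT z|poincare_measure. (cmod (f z))\<^sup>2 * log_weight z ^ k)"
    using eq by (simp add: sums_iff)
  then show ?thesis
    using sums_ennreal[OF nn I0] by simp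
qed

subsection \<open>Inner products and orthonormal bases\<close>

lemma bergman_spaceI:
  assumes hol: "f holomorphic_on punctured_disk"
    and int: "integrable poincare_measure g"
    and le: "\<And>z. z \<in> punctured_disk \<Longrightarrow> (cmod (f z))\<^sup>2 * log_weight z ^ k \<le> g z"
  shows "f \<in> bergman_space k"
proof -
  have "integrable poincare_measure (\<lambda>z. (cmod (f z))\<^sup>2 * log_weight z ^ k)"
  proof (rule Bochner_Integration.integrable_bound[OF int])
    show "(\<lambda>z. (cmod (f z))\<^sup>2 * log_weight z ^ k) \<in> borel_measurable poincare_measure"
      by (intro borel_measurable_poincare_continuous continuous_on_weighted_square
          holomorphic_on_imp_continuous_on hol)
    show "AE z in poincare_measure. norm ((cmod (f z))\<^sup>2 * log_weight z ^ k) \<le> norm (g z)"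
    proof (rule AE_I2)
      fix z assume "z \<in> space poincare_measure"
      then have z: "z \<in> punctured_disk" by simp
      then have "0 \<le> (cmod (f z))\<^sup>2 * log_weight z ^ k" by (simp add: log_weight_nonneg)
      then show "norm ((cmod (f z))\<^sup>2 * log_weight z ^ k) \<le> norm (g z)"
        using le[OF z] by simp
    qed
  qed
  with hol show ?thesis by (simp add: bergman_space_def)
qed

lemma bergman_space_add:
  assumes f: "f \<in> bergman_space k" and g: "g \<in> bergman_space k"
  shows "(\<lambda>z. f z + g z) \<in> bergman_space k"
proof (rule bergman_spaceI)
  show "(\<lambda>z. f z + g z) holomorphic_on punctured_disk"
    by (intro holomorphic_intros bergman_spaceD(1)[OF f] bergman_spaceD(1)[OF g])
  show "integrable poincare_measure
      (\<lambda>z. 2 * ((cmod (f z))\<^sup>2 * log_weight z ^ k) + 2 * ((cmod (g z))\<^sup>2 * log_weight z ^ k))"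
    by (intro Bochner_Integration.integrable_add integrable_mult_right bergman_spaceD(3)[OF f] bergman_spaceD(3)[OF g])
  fix z assume z: "z \<in> punctured_disk"
  have "(cmod (f z + g z))\<^sup>2 \<le> (cmod (f z) + cmod (g z))\<^sup>2"
    by (intro power_mono norm_triangle_ineq) simp
  also have "\<dots> \<le> 2 * (cmod (f z))\<^sup>2 + 2 * (cmod (g z))\<^sup>2"
    using sum_squares_bound[of "cmod (f z)" "cmod (g z)"] by (simp add: power2_sum)
  finally have "(cmod (f z + g z))\<^sup>2 * log_weight z ^ k \<le>
      (2 * (cmod (f z))\<^sup>2 + 2 * (cmod (g z))\<^sup>2) * log_weight z ^ k"
    by (intro mult_right_mono) (simp_all add: log_weight_nonneg[OF z])
  then show "(cmod (f z + g z))\<^sup>2 * log_weight z ^ k \<le>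
      2 * ((cmod (f z))\<^sup>2 * log_weight z ^ k) + 2 * ((cmod (g z))\<^sup>2 * log_weight z ^ k)"
    by (simp add: algebra_simps)
qed

lemma bergman_space_cmult:
  assumes f: "f \<in> bergman_space k"
  shows "(\<lambda>z. c * f z) \<in> bergman_space k"
proof (rule bergman_spaceI)
  show "(\<lambda>z. c * f z) holomorphic_on punctured_disk"
    by (intro holomorphic_intros bergman_spaceD(1)[OF f])
  show "integrable poincare_measure (\<lambda>z. (cmod c)\<^sup>2 * ((cmod (f z))\<^sup>2 * log_weight z ^ k))"
    by (intro integrable_mult_right bergman_spaceD(3)[OF f])
qed (simp add: norm_mult power_mult_distrib)

lemma bergman_space_zero: "(\<lambda>z. 0) \<in> bergman_space k"
  by (simp add: bergman_space_def)

lemma bergman_space_sum: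
  assumes "\<And>b. b \<in> F \<Longrightarrow> g b \<in> bergman_space k"
  shows "(\<lambda>z. \<Sum>b\<in>F. g b z) \<in> bergman_space k"
  using assms
  by (induction F rule: infinite_finite_induct)
    (simp_all add: bergman_space_zero bergman_space_add)

lemma bergman_space_diff:
  assumes f: "f \<in> bergman_space k" and g: "g \<in> bergman_space k"
  shows "(\<lambda>z. f z - g z) \<in> bergman_space k"
  using bergman_space_add[OF f bergman_space_cmult[OF g, of "-1"]] by simp

lemma bergman_inner_integrable:
  assumes f: "f \<in> bergman_space k" and g: "g \<in> bergman_space k"
  shows "integrable poincare_measure (\<lambda>z. f z * cnj (g z) * of_real (log_weight z ^ k))"
proof (rule Bochner_Integration.integrable_bound)
  show "integrable poincare_measure
      (\<lambda>z. (cmod (f z))\<^sup>2 * log_weight z ^ k + (cmod (g z))\<^sup>2 * log_weight z ^ k)"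
    by (intro Bochner_Integration.integrable_add bergman_spaceD(3)[OF f] bergman_spaceD(3)[OF g])
  show "(\<lambda>z. f z * cnj (g z) * of_real (log_weight z ^ k)) \<in> borel_measurable poincare_measure"
    by (intro borel_measurable_poincare_continuous continuous_intros continuous_on_log_weight
        bergman_spaceD(2)[OF f] bergman_spaceD(2)[OF g])
  show "AE z in poincare_measure. norm (f z * cnj (g z) * of_real (log_weight z ^ k)) \<le>
      norm ((cmod (f z))\<^sup>2 * log_weight z ^ k + (cmod (g z))\<^sup>2 * log_weight z ^ k)"
  proof (rule AE_I2)
    fix z assume "z \<in> space poincare_measure"
    then have w: "0 \<le> log_weight z ^ k" using log_weight_nonneg by simp
    have "cmod (f z) * cmod (g z) \<le> (cmod (f z))\<^sup>2 + (cmod (g z))\<^sup>2"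
      using sum_squares_bound[of "cmod (f z)" "cmod (g z)"] mult_nonneg_nonneg[OF norm_ge_zero norm_ge_zero, of "f z" "g z"]
      by linarith
    then have "cmod (f z) * cmod (g z) * log_weight z ^ k \<le> ((cmod (f z))\<^sup>2 + (cmod (g z))\<^sup>2) * log_weight z ^ k"
      using w by (rule mult_right_mono)
    moreover have "norm (f z * cnj (g z) * of_real (log_weight z ^ k)) = cmod (f z) * cmod (g z) * log_weight z ^ k"
      using w by (simp only: norm_mult norm_of_real complex_mod_cnj abs_of_nonneg)
    moreover have "norm ((cmod (f z))\<^sup>2 * log_weight z ^ k + (cmod (g z))\<^sup>2 * log_weight z ^ k) =
        ((cmod (f z))\<^sup>2 + (cmod (g z))\<^sup>2) * log_weight z ^ k"
      using w by (simp add: distrib_right)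
    ultimately show "norm (f z * cnj (g z) * of_real (log_weight z ^ k)) \<le>
      norm ((cmod (f z))\<^sup>2 * log_weight z ^ k + (cmod (g z))\<^sup>2 * log_weight z ^ k)"
      by simp
  qed
qed

lemma bergman_inner_add_left:
  assumes "f \<in> bergman_space k" "g \<in> bergman_space k" "h \<in> bergman_space k"
  shows "bergman_inner k (\<lambda>z. f z + g z) h = bergman_inner k f h + bergman_inner k g h"
  using Bochner_Integration.integral_add[OF bergman_inner_integrable[OF assms(1,3)] bergman_inner_integrable[OF assms(2,3)]]
  by (simp add: bergman_inner_def distrib_right)

lemma bergman_inner_cmult_left:
  "bergman_inner k (\<lambda>z. c * f z) h = c * bergman_inner k f h"
  by (simp add: bergman_inner_def mult.assoc)

lemma bergman_inner_zero_left: "bergman_inner k (\<lambda>z. 0) h = 0"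
  by (simp add: bergman_inner_def)

lemma bergman_inner_cnj: "cnj (bergman_inner k f g) = bergman_inner k g f"
  unfolding bergman_inner_def Bochner_Integration.integral_cnj[symmetric] by (simp add: mult.commute)

lemma bergman_inner_sum_left:
  assumes "\<And>b. b \<in> F \<Longrightarrow> g b \<in> bergman_space k" "h \<in> bergman_space k"
  shows "bergman_inner k (\<lambda>z. \<Sum>b\<in>F. c b * g b z) h = (\<Sum>b\<in>F. c b * bergman_inner k (g b) h)"
  using assms
proof (induction F rule: infinite_finite_induct)
  case (insert x F)
  then show ?case
    by (simp add: bergman_inner_add_left bergman_inner_cmult_left bergman_space_cmult bergman_space_sum)
qed (simp_all add: bergman_inner_zero_left)

lemma bergman_inner_diff_left:
  assumes "f \<in> bergman_space k" "g \<in> bergman_space k" "h \<in> bergman_space k"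
  shows "bergman_inner k (\<lambda>z. f z - g z) h = bergman_inner k f h - bergman_inner k g h"
  using bergman_inner_add_left[OF assms(1) bergman_space_cmult[OF assms(2)] assms(3), of "-1"]
    bergman_inner_cmult_left[of k "-1" g h] by simp

lemma bergman_norm_square: "(bergman_norm k f)\<^sup>2 = (LINT z|poincare_measure. (cmod (f z))\<^sup>2 * log_weight z ^ k)"
  unfolding bergman_norm_def
  by (intro real_sqrt_pow2 Bochner_Integration.integral_nonneg) (simp add: log_weight_nonneg)

lemma bergman_norm_nonneg: "0 \<le> bergman_norm k f"
  unfolding bergman_norm_def
  by (intro real_sqrt_ge_zero Bochner_Integration.integral_nonneg) (simp add: log_weight_nonneg)

lemma bergman_inner_self: "bergman_inner k f f = of_real ((bergman_norm k f)\<^sup>2)"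
proof -
  have "bergman_inner k f f = (LINT z|poincare_measure. of_real ((cmod (f z))\<^sup>2 * log_weight z ^ k))"
    unfolding bergman_inner_def of_real_mult complex_norm_square ..
  then show ?thesis
    by (simp only: integral_complex_of_real bergman_norm_square)
qed

section \<open>Orthonormal systems, Bessel and Parseval\<close>

text \<open>The part of \<open>bergman_orthonormal_basis\<close> that passes to subsets, as needed
  for finite subsets of a basis.\<close>

definition bergman_orthonormal :: "nat \<Rightarrow> (complex \<Rightarrow> complex) set \<Rightarrow> bool" where
  "bergman_orthonormal k B \<longleftrightarrow> B \<subseteq> bergman_space k \<and>
     (\<forall>f\<in>B. \<forall>g\<in>B. bergman_inner k f g = (if f = g then 1 else 0))"

lemma bergman_orthonormal_subset:
  "bergman_orthonormal k B \<Longrightarrow> F \<subseteq> B \<Longrightarrow> bergman_orthonormal k F"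
  by (simp add: bergman_orthonormal_def subset_eq)

text \<open>Completing the square in the coefficients. Taking
  \<open>c b = bergman_inner k f b\<close> gives Bessel's inequality, and dropping the last sum
  shows that no other coefficients approximate better.\<close>

lemma bergman_norm_diff_orthonormal:
  assumes F: "finite F" "bergman_orthonormal k F" and f: "f \<in> bergman_space k"
  shows "(bergman_norm k (\<lambda>z. f z - (\<Sum>b\<in>F. c b * b z)))\<^sup>2 =
    (bergman_norm k f)\<^sup>2 - (\<Sum>b\<in>F. (cmod (bergman_inner k f b))\<^sup>2) +
    (\<Sum>b\<in>F. (cmod (c b - bergman_inner k f b))\<^sup>2)"
proof -
  define S where "S = (\<lambda>z. \<Sum>b\<in>F. c b * b z)"
  let ?\<alpha> = "\<lambda>b. bergman_inner k f b"
  have F_H: "b \<in> bergman_space k" if "b \<in> F" for b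
    using F(2) that by (auto simp: bergman_orthonormal_def)
  have S: "S \<in> bergman_space k"
    unfolding S_def by (intro bergman_space_sum bergman_space_cmult F_H)
  have inner_S: "bergman_inner k S g = (\<Sum>b\<in>F. c b * bergman_inner k b g)" if "g \<in> bergman_space k" for g
    unfolding S_def using F_H that by (intro bergman_inner_sum_left)
  have Sb: "bergman_inner k S b = c b" if b: "b \<in> F" for b
  proof -
    have "bergman_inner k S b = (\<Sum>b'\<in>F. if b' = b then c b' else 0)"
      unfolding inner_S[OF F_H[OF b]] using F(2) b
      by (intro sum.cong refl) (simp add: bergman_orthonormal_def)
    then show ?thesis using b F(1) by (simp add: sum.delta)
  qed
  have SS: "bergman_inner k S S = (\<Sum>b\<in>F. c b * cnj (c b))"
    unfolding inner_S[OF S] by (intro sum.cong refl) (simp add: Sb flip: bergman_inner_cnj[of k S])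
  have Sf: "bergman_inner k S f = (\<Sum>b\<in>F. c b * cnj (?\<alpha> b))"
    unfolding inner_S[OF f] by (simp add: bergman_inner_cnj)
  have fS: "bergman_inner k f S = (\<Sum>b\<in>F. cnj (c b) * ?\<alpha> b)"
    using arg_cong[OF Sf, of cnj] by (simp add: bergman_inner_cnj)
  have D: "(\<lambda>z. f z - S z) \<in> bergman_space k"
    by (rule bergman_space_diff[OF f S])
  have right: "bergman_inner k h (\<lambda>z. f z - S z) = bergman_inner k h f - bergman_inner k h S"
    if "h \<in> bergman_space k" for h
    using arg_cong[OF bergman_inner_diff_left[OF f S that], of cnj] by (simp add: bergman_inner_cnj)
  have "complex_of_real ((bergman_norm k (\<lambda>z. f z - S z))\<^sup>2) =
      bergman_inner k (\<lambda>z. f z - S z) (\<lambda>z. f z - S z)"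
    by (rule bergman_inner_self[symmetric])
  also have "\<dots> = bergman_inner k f f - bergman_inner k f S - bergman_inner k S f + bergman_inner k S S"
    unfolding bergman_inner_diff_left[OF f S D] right[OF f] right[OF S] by simp
  also have "\<dots> = of_real ((bergman_norm k f)\<^sup>2) + (\<Sum>b\<in>F. c b * cnj (c b) - cnj (c b) * ?\<alpha> b - c b * cnj (?\<alpha> b))"
    unfolding fS Sf SS bergman_inner_self[of k f] by (simp add: sum_subtractf)
  also have "(\<Sum>b\<in>F. c b * cnj (c b) - cnj (c b) * ?\<alpha> b - c b * cnj (?\<alpha> b)) =
      (\<Sum>b\<in>F. of_real ((cmod (c b - ?\<alpha> b))\<^sup>2) - of_real ((cmod (?\<alpha> b))\<^sup>2))"
    by (intro sum.cong refl) (simp only: complex_norm_square, simp add: algebra_simps)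
  also have "of_real ((bergman_norm k f)\<^sup>2) + \<dots> =
      complex_of_real ((bergman_norm k f)\<^sup>2 - (\<Sum>b\<in>F. (cmod (?\<alpha> b))\<^sup>2) + (\<Sum>b\<in>F. (cmod (c b - ?\<alpha> b))\<^sup>2))"
    by (simp add: sum_subtractf)
  finally show ?thesis
    unfolding S_def of_real_eq_iff .
qed

lemma bessel_inequality:
  assumes "finite F" "bergman_orthonormal k F" "f \<in> bergman_space k"
  shows "(\<Sum>b\<in>F. (cmod (bergman_inner k f b))\<^sup>2) \<le> (bergman_norm k f)\<^sup>2"
proof -
  have "0 \<le> (bergman_norm k (\<lambda>z. f z - (\<Sum>b\<in>F. bergman_inner k f b * b z)))\<^sup>2" by simp
  then show ?thesis
    unfolding bergman_norm_diff_orthonormal[OF assms] by simp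
qed

lemma bergman_orthonormal_basisD:
  assumes "bergman_orthonormal_basis k B"
  shows "bergman_orthonormal k B" "F \<subseteq> B \<Longrightarrow> bergman_orthonormal k F"
  using assms unfolding bergman_orthonormal_basis_def bergman_orthonormal_def by blast+

text \<open>Density supplies a finite \<open>F\<close> with some coefficients within
  \<open>sqrt e\<close> of \<open>f\<close>. The inner products do at least as well, so the partial
  sum over \<open>F\<close> already exceeds the squared norm minus \<open>e\<close>; Bessel bounds
  all larger partial sums from above.\<close>

lemma parseval_identity:
  assumes B: "bergman_orthonormal_basis k B" and f: "f \<in> bergman_space k"
  shows "((\<lambda>b. (cmod (bergman_inner k f b))\<^sup>2) has_sum (bergman_norm k f)\<^sup>2) B"
  unfolding has_sum_def tendsto_iff eventually_finite_subsets_at_top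
proof (intro allI impI)
  let ?N = "(bergman_norm k f)\<^sup>2" and ?a = "\<lambda>b. (cmod (bergman_inner k f b))\<^sup>2"
  fix e :: real assume e: "e > 0"
  obtain F c where F: "finite F" "F \<subseteq> B" "bergman_norm k (\<lambda>z. f z - (\<Sum>b\<in>F. c b * b z)) < sqrt e"
    using B f e unfolding bergman_orthonormal_basis_def by (meson real_sqrt_gt_zero)
  have "?N - sum ?a F \<le> (bergman_norm k (\<lambda>z. f z - (\<Sum>b\<in>F. c b * b z)))\<^sup>2"
    unfolding bergman_norm_diff_orthonormal[OF F(1) bergman_orthonormal_basisD(2)[OF B F(2)] f]
    by (simp add: sum_nonneg)
  also have "\<dots> < (sqrt e)\<^sup>2"
    by (intro power_strict_mono F(3) bergman_norm_nonneg) simp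
  finally have lower: "?N - sum ?a F < e" using e by simp
  show "\<exists>X. finite X \<and> X \<subseteq> B \<and> (\<forall>Y. finite Y \<and> X \<subseteq> Y \<and> Y \<subseteq> B \<longrightarrow> dist (sum ?a Y) ?N < e)"
  proof (intro exI[of _ F] conjI allI impI)
    fix Y assume Y: "finite Y \<and> F \<subseteq> Y \<and> Y \<subseteq> B"
    have "sum ?a F \<le> sum ?a Y" using Y by (intro sum_mono2) auto
    moreover have "sum ?a Y \<le> ?N"
      using Y by (intro bessel_inequality f bergman_orthonormal_basisD(2)[OF B]) auto
    ultimately show "dist (sum ?a Y) ?N < e" using lower by (simp add: dist_real_def)
  qed (use F in auto)
qed

section \<open>The monomial basis\<close>

lemma power_in_bergman_space:
  assumes "a \<ge> 1" "k \<ge> 2"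
  shows "(\<lambda>z. z ^ a) \<in> bergman_space k"
    and "(LINT z|poincare_measure. (cmod (z ^ a))\<^sup>2 * log_weight z ^ k) = monomial_norm2 k a"
proof -
  have eq: "(cmod (z ^ a))\<^sup>2 * log_weight z ^ k = cmod z ^ (2 * a) * log_weight z ^ k" for z
    by (simp add: norm_power mult.commute flip: power_mult)
  have "has_bochner_integral poincare_measure (\<lambda>z. (cmod (z ^ a))\<^sup>2 * log_weight z ^ k) (monomial_norm2 k a)"
  proof (rule has_bochner_integral_nn_integral)
    show "(\<lambda>z. (cmod (z ^ a))\<^sup>2 * log_weight z ^ k) \<in> borel_measurable poincare_measure"
      by (intro borel_measurable_poincareI) measurable
    show "(\<integral>\<^sup>+z. ennreal ((cmod (z ^ a))\<^sup>2 * log_weight z ^ k) \<partial>poincare_measure) = ennreal (monomial_norm2 k a)"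
      unfolding eq monomial_norm2_def by (rule nn_integral_poincare_monomial[OF assms])
  qed (auto intro!: AE_I2 simp: log_weight_nonneg monomial_norm2_nonneg)
  then show "(\<lambda>z. z ^ a) \<in> bergman_space k"
    and "(LINT z|poincare_measure. (cmod (z ^ a))\<^sup>2 * log_weight z ^ k) = monomial_norm2 k a"
    by (auto simp: bergman_space_def has_bochner_integral_iff intro!: holomorphic_intros)
qed

text \<open>The weight is radial, so averaging the integrand over circles isolates the coefficient
  of \<open>f\<close>; what remains is the squared norm of the monomial.\<close>

lemma bergman_inner_power:
  assumes f: "f \<in> bergman_space k" and a: "a \<ge> 1" and k: "k \<ge> 2"
  shows "bergman_inner k f (\<lambda>z. z ^ a) = fourier_coeff f a * of_real (monomial_norm2 k a)"
proof -
  note hol = bergman_spaceD(1)[OF f] and cont = bergman_spaceD(2)[OF f]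
  let ?h = "\<lambda>z. f z * cnj (z ^ a) * of_real (log_weight z ^ k)"
  have "bergman_inner k f (\<lambda>z. z ^ a) = (LINT z|poincare_measure. circle_mean ?h z)"
    unfolding bergman_inner_def
    by (intro integral_poincare_circle_mean bergman_inner_integrable f power_in_bergman_space a k
        continuous_intros cont continuous_on_log_weight)
  also have "\<dots> = (LINT z|poincare_measure. fourier_coeff f a * of_real ((cmod (z ^ a))\<^sup>2 * log_weight z ^ k))"
  proof (rule Bochner_Integration.integral_cong)
    fix z assume "z \<in> space poincare_measure"
    then have z: "z \<in> punctured_disk" by simp
    have "circle_mean ?h z = circle_mean (\<lambda>w. f w * cnj (w ^ a)) z * of_real (log_weight z ^ k)"
      by (rule circle_mean_log_weight)
    also have "\<dots> = fourier_coeff f a * of_real ((cmod (z ^ a))\<^sup>2 * log_weight z ^ k)"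
      unfolding circle_mean_mult_cnj_power[OF hol z]
      by (simp add: norm_power mult.commute[of 2] power_mult)
    finally show "circle_mean ?h z = fourier_coeff f a * of_real ((cmod (z ^ a))\<^sup>2 * log_weight z ^ k)" .
  qed simp
  also have "\<dots> = fourier_coeff f a * of_real (monomial_norm2 k a)"
    by (simp only: integral_mult_right_zero integral_complex_of_real power_in_bergman_space(2)[OF a k])
  finally show ?thesis .
qed

definition bergman_monomial :: "nat \<Rightarrow> nat \<Rightarrow> complex \<Rightarrow> complex" where
  "bergman_monomial k a = (\<lambda>z. of_real (1 / sqrt (monomial_norm2 k a)) * z ^ a)"

lemma bergman_monomial_in_space:
  "a \<ge> 1 \<Longrightarrow> k \<ge> 2 \<Longrightarrow> bergman_monomial k a \<in> bergman_space k"
  unfolding bergman_monomial_def by (intro bergman_space_cmult power_in_bergman_space)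

lemma bergman_inner_monomial:
  assumes f: "f \<in> bergman_space k" and a: "a \<ge> 1" and k: "k \<ge> 2"
  shows "bergman_inner k f (bergman_monomial k a) = fourier_coeff f a * of_real (sqrt (monomial_norm2 k a))"
proof -
  let ?N = "monomial_norm2 k a"
  have "bergman_inner k f (bergman_monomial k a) = cnj (bergman_inner k (bergman_monomial k a) f)"
    by (simp only: bergman_inner_cnj)
  also have "\<dots> = of_real (1 / sqrt ?N) * bergman_inner k f (\<lambda>z. z ^ a)"
    unfolding bergman_monomial_def bergman_inner_cmult_left by (simp add: bergman_inner_cnj)
  also have "\<dots> = fourier_coeff f a * of_real (?N / sqrt ?N)"
    unfolding bergman_inner_power[OF f a k] by simp
  also have "?N / sqrt ?N = sqrt ?N"
    by (rule real_div_sqrt[OF monomial_norm2_nonneg])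
  finally show ?thesis .
qed

lemma bergman_inner_monomial_monomial:
  assumes a: "a \<ge> 1" and b: "b \<ge> 1" and k: "k \<ge> 2"
  shows "bergman_inner k (bergman_monomial k a) (bergman_monomial k b) = (if a = b then 1 else 0)"
proof -
  have "fourier_coeff (bergman_monomial k a) b = of_real (1 / sqrt (monomial_norm2 k a)) * fourier_coeff (\<lambda>z. z ^ a) b"
    unfolding fourier_coeff_def bergman_monomial_def times_divide_eq_right[symmetric] circle_mean_cmult ..
  then show ?thesis
    using bergman_inner_monomial[OF bergman_monomial_in_space[OF a k] b k] monomial_norm2_pos[OF a, of k]
    by (auto simp: fourier_coeff_power)
qed

text \<open>This guarantees that the \<open>SOME\<close> in \<open>bergman_kernel\<close> picks a
  genuine basis. By \<open>bergman_norm_sums\<close> finitely many monomials capture the norm of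
  \<open>f\<close> up to \<open>e\<^sup>2\<close>, and completing the square turns this into an
  approximation.\<close>

lemma bergman_orthonormal_basis_monomials:
  assumes k: "k \<ge> 2"
  shows "bergman_orthonormal_basis k (bergman_monomial k ` {1..})"
proof -
  note inner = bergman_inner_monomial_monomial[OF _ _ k]
  \<comment> \<open>A basis is a set of functions; injectivity relates equality of its elements to
    equality of exponents and allows reindexing the sums.\<close>
  have inj: "inj_on (bergman_monomial k) {1..}"
  proof (rule inj_onI)
    fix a b assume "a \<in> {1..}" "b \<in> {1..}" "bergman_monomial k a = bergman_monomial k b"
    then show "a = b" using inner[of a a] inner[of a b] by (auto split: if_splits)
  qed
  have orth: "bergman_orthonormal k (bergman_monomial k ` {1..})"
    unfolding bergman_orthonormal_def
    using bergman_monomial_in_space[OF _ k] inner inj_onD[OF inj] by (fastforce simp: image_iff)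
  have dense: "\<exists>F c. finite F \<and> F \<subseteq> bergman_monomial k ` {1..} \<and>
      bergman_norm k (\<lambda>z. f z - (\<Sum>b\<in>F. c b * b z)) < e"
    if f: "f \<in> bergman_space k" and e: "e > 0" for f e
  proof -
    let ?t = "\<lambda>n. (cmod (fourier_coeff f n))\<^sup>2 * monomial_norm2 k n"
    have "?t sums (bergman_norm k f)\<^sup>2"
      unfolding bergman_norm_square by (rule bergman_norm_sums[OF f k])
    then have "eventually (\<lambda>n. dist (\<Sum>i<n. ?t i) ((bergman_norm k f)\<^sup>2) < e\<^sup>2) sequentially"
      unfolding sums_def using e by (intro tendstoD) auto
    then obtain n where n: "dist (\<Sum>i<n. ?t i) ((bergman_norm k f)\<^sup>2) < e\<^sup>2"
      by (auto simp: eventually_sequentially)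
    define F where "F = bergman_monomial k ` {1..<n}"
    have F: "finite F" "F \<subseteq> bergman_monomial k ` {1..}"
      by (auto simp: F_def)
    have F_orth: "bergman_orthonormal k F"
      by (rule bergman_orthonormal_subset[OF orth F(2)])
    have "(\<Sum>i<n. ?t i) = (\<Sum>i\<in>{1..<n}. ?t i)"
      by (intro sum.mono_neutral_right) (auto simp: fourier_coeff_0[OF f k] not_less_eq_eq)
    also have "\<dots> = (\<Sum>i\<in>{1..<n}. (cmod (bergman_inner k f (bergman_monomial k i)))\<^sup>2)"
      by (intro sum.cong refl)
        (simp add: bergman_inner_monomial[OF f _ k] norm_mult power_mult_distrib monomial_norm2_nonneg)
    also have "\<dots> = (\<Sum>b\<in>F. (cmod (bergman_inner k f b))\<^sup>2)"
      unfolding F_def by (subst sum.reindex) (auto intro: inj_on_subset[OF inj])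
    finally have "(bergman_norm k (\<lambda>z. f z - (\<Sum>b\<in>F. bergman_inner k f b * b z)))\<^sup>2 < e\<^sup>2"
      unfolding bergman_norm_diff_orthonormal[OF F(1) F_orth f] using n by (simp add: dist_real_def)
    then have "bergman_norm k (\<lambda>z. f z - (\<Sum>b\<in>F. bergman_inner k f b * b z)) < e"
      using e by (intro power2_less_imp_less[of _ e]) auto
    then show ?thesis using F by (intro exI[of _ F] exI[of _ "bergman_inner k f"]) simp
  qed
  show ?thesis
    using orth dense unfolding bergman_orthonormal_basis_def bergman_orthonormal_def by blast
qed

subsection \<open>The reproducing kernel\<close>

lemma summable_power_mult_geometric:
  fixes r :: real
  assumes r: "0 \<le> r" "r < 1"
  shows "summable (\<lambda>n. real n ^ m * r ^ n)"
proof (rule root_test_convergence)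
  have "(\<lambda>n. root n (real n) ^ m * r) \<longlonglongrightarrow> 1 ^ m * r"
    by (intro tendsto_intros LIMSEQ_root)
  moreover have "eventually (\<lambda>n. root n (real n) ^ m * r = root n (norm (real n ^ m * r ^ n))) sequentially"
    using eventually_gt_at_top[of 0]
  proof eventually_elim
    case (elim n)
    then show ?case
      using r by (simp add: real_root_mult real_root_power real_root_power_cancel abs_mult)
  qed
  ultimately show "(\<lambda>n. root n (norm (real n ^ m * r ^ n))) \<longlonglongrightarrow> r"
    by (simp add: tendsto_cong)
qed (use r in simp)

lemma inverse_monomial_norm2:
  "1 / monomial_norm2 k n = real n ^ (k - 1) / (2 * pi * fact (k - 2))"
  by (simp add: monomial_norm2_def)

lemma summable_inverse_monomial_norm2:
  assumes "0 \<le> r" "r < 1"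
  shows "summable (\<lambda>n. 1 / monomial_norm2 k n * r ^ n)"
  using summable_divide[OF summable_power_mult_geometric[OF assms, of "k - 1"], of "2 * pi * fact (k - 2)"]
  by (simp add: inverse_monomial_norm2)

text \<open>The sum of cnj (e z) * e w over the normalised monomials e. For k \<ge> 2 the index 0
  contributes nothing, since \<open>1 / monomial_norm2 k 0\<close> is 0 by division by zero.\<close>

definition reproducing_kernel :: "nat \<Rightarrow> complex \<Rightarrow> complex \<Rightarrow> complex" where
  "reproducing_kernel k z w = (\<Sum>n. of_real (1 / monomial_norm2 k n) * (w * cnj z) ^ n)"

lemma reproducing_kernel_sums:
  assumes "cmod u < 1"
  shows "(\<lambda>n. of_real (1 / monomial_norm2 k n) * u ^ n) sums
    (\<Sum>n. of_real (1 / monomial_norm2 k n) * u ^ n)"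
proof (rule summable_sums, rule summable_norm_cancel)
  have "norm (of_real (1 / monomial_norm2 k n) * u ^ n) = 1 / monomial_norm2 k n * cmod u ^ n" for n
    unfolding norm_mult norm_of_real norm_power by (simp add: monomial_norm2_nonneg)
  then show "summable (\<lambda>n. norm (of_real (1 / monomial_norm2 k n) * u ^ n))"
    using summable_inverse_monomial_norm2[OF norm_ge_zero assms, of k] by simp
qed

text \<open>The partial sums \<open>S N\<close> are combinations of monomials, and their inner
  products with \<open>f\<close> are the partial sums of its power series at \<open>z\<close>.
  Dominated convergence carries this over to the limit.\<close>

lemma
  assumes z: "z \<in> punctured_disk" and k: "k \<ge> 2"
  shows reproducing_kernel_in_space: "reproducing_kernel k z \<in> bergman_space k"
    and bergman_inner_reproducing_kernel:
      "f \<in> bergman_space k \<Longrightarrow> bergman_inner k f (reproducing_kernel k z) = f z"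
proof -
  let ?K = "reproducing_kernel k z"
  let ?\<gamma> = "\<lambda>n. 1 / monomial_norm2 k n"
  have z1: "cmod z < 1" using z by (simp add: punctured_disk_def)
  have \<gamma>0: "?\<gamma> 0 = 0" using k by (simp add: inverse_monomial_norm2)
  have \<gamma>_nonneg: "0 \<le> ?\<gamma> n" for n by (simp add: monomial_norm2_nonneg)
  define C where "C = (\<Sum>n. ?\<gamma> n * cmod z ^ n)"
  have sumC: "summable (\<lambda>n. ?\<gamma> n * cmod z ^ n)"
    using z1 by (intro summable_inverse_monomial_norm2) auto
  \<comment> \<open>Starting at 1 leaves a factor \<open>w\<close> in every term, hence the uniform
    bound C |w|. This bound is square integrable, whereas a constant would not be, because of the
    puncture.\<close>
  define S where "S = (\<lambda>N w. \<Sum>n\<in>{1..<N}. (of_real (?\<gamma> n) * cnj z ^ n) * w ^ n)"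
  have wz: "cmod (w * cnj z) < 1" if "w \<in> punctured_disk" for w
  proof -
    have "cmod w * cmod z < 1 * 1"
      using that z1 by (intro mult_strict_mono) (auto simp: punctured_disk_def)
    then show ?thesis by (simp add: norm_mult)
  qed
  have S_eq: "S N w = (\<Sum>n<N. of_real (?\<gamma> n) * (w * cnj z) ^ n)" for N w
  proof -
    have "(\<Sum>n<N. of_real (?\<gamma> n) * (w * cnj z) ^ n) = (\<Sum>n\<in>{1..<N}. of_real (?\<gamma> n) * (w * cnj z) ^ n)"
      using \<gamma>0 by (intro sum.mono_neutral_right) (auto simp: not_less_eq_eq)
    then show ?thesis
      by (simp add: S_def power_mult_distrib mult_ac)
  qed
  have S_lim: "(\<lambda>N. S N w) \<longlonglongrightarrow> ?K w" if "w \<in> punctured_disk" for w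
    using reproducing_kernel_sums[OF wz[OF that], of k]
    unfolding sums_def S_eq reproducing_kernel_def .
  have S_bound: "cmod (S N w) \<le> C * cmod w" if w: "w \<in> punctured_disk" for N w
  proof -
    have "cmod (S N w) \<le> (\<Sum>n\<in>{1..<N}. ?\<gamma> n * cmod z ^ n * cmod w)"
      unfolding S_def
    proof (rule sum_norm_le)
      fix n assume n: "n \<in> {1..<N}"
      have "cmod w ^ n \<le> cmod w ^ 1"
        using n w by (intro power_decreasing) (auto simp: punctured_disk_def)
      then have "?\<gamma> n * cmod z ^ n * cmod w ^ n \<le> ?\<gamma> n * cmod z ^ n * cmod w ^ 1"
        using \<gamma>_nonneg[of n] by (intro mult_left_mono) auto
      then show "cmod (of_real (?\<gamma> n) * cnj z ^ n * w ^ n) \<le> ?\<gamma> n * cmod z ^ n * cmod w"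
        unfolding norm_mult norm_of_real norm_power complex_mod_cnj abs_of_nonneg[OF \<gamma>_nonneg] by simp
    qed
    also have "\<dots> = (\<Sum>n\<in>{1..<N}. ?\<gamma> n * cmod z ^ n) * cmod w"
      by (rule sum_distrib_right[symmetric])
    also have "\<dots> \<le> C * cmod w"
      unfolding C_def using \<gamma>_nonneg
      by (intro mult_right_mono sum_le_suminf sumC) auto
    finally show ?thesis .
  qed
  have K_bound: "cmod (?K w) \<le> C * cmod w" if w: "w \<in> punctured_disk" for w
    using tendsto_norm[OF S_lim[OF w]] by (rule LIMSEQ_le_const2) (use S_bound[OF w] in auto)
  have hol: "?K holomorphic_on punctured_disk"
  proof -
    have "(\<lambda>u. \<Sum>n. of_real (?\<gamma> n) * u ^ n) holomorphic_on ball 0 1"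
      by (rule power_series_holomorphic[where a = "\<lambda>n. of_real (?\<gamma> n)"])
        (use reproducing_kernel_sums[of _ k] in simp)
    then have "((\<lambda>u. \<Sum>n. of_real (?\<gamma> n) * u ^ n) \<circ> (\<lambda>w. w * cnj z)) holomorphic_on punctured_disk"
      using wz by (intro holomorphic_on_compose_gen[where t = "ball 0 1"] holomorphic_intros) auto
    then show ?thesis
      by (simp add: o_def reproducing_kernel_def[abs_def])
  qed
  have dom: "integrable poincare_measure (\<lambda>w. C\<^sup>2 * ((cmod (w ^ 1))\<^sup>2 * log_weight w ^ k))"
    by (intro integrable_mult_right bergman_spaceD(3) power_in_bergman_space k) simp
  show K: "?K \<in> bergman_space k"
  proof (rule bergman_spaceI[OF hol dom])
    fix w assume w: "w \<in> punctured_disk"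
    have "(cmod (?K w))\<^sup>2 \<le> (C * cmod w)\<^sup>2"
      by (intro power_mono K_bound w) simp
    then have "(cmod (?K w))\<^sup>2 * log_weight w ^ k \<le> (C * cmod w)\<^sup>2 * log_weight w ^ k"
      by (intro mult_right_mono) (simp_all add: log_weight_nonneg[OF w])
    then show "(cmod (?K w))\<^sup>2 * log_weight w ^ k \<le> C\<^sup>2 * ((cmod (w ^ 1))\<^sup>2 * log_weight w ^ k)"
      by (simp add: power_mult_distrib mult.assoc)
  qed
  show "bergman_inner k f ?K = f z" if f: "f \<in> bergman_space k"
  proof (rule LIMSEQ_unique)
    have S_H: "S N \<in> bergman_space k" for N
      unfolding S_def by (intro bergman_space_sum bergman_space_cmult power_in_bergman_space k) simp
    have inner_S: "bergman_inner k f (S N) = (\<Sum>n<N. fourier_coeff f n * z ^ n)" for N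
    proof -
      have "bergman_inner k (S N) f = (\<Sum>n\<in>{1..<N}. (of_real (?\<gamma> n) * cnj z ^ n) * bergman_inner k (\<lambda>w. w ^ n) f)"
        unfolding S_def by (intro bergman_inner_sum_left power_in_bergman_space k f) simp
      then have "cnj (bergman_inner k (S N) f) =
          (\<Sum>n\<in>{1..<N}. (of_real (?\<gamma> n) * z ^ n) * bergman_inner k f (\<lambda>w. w ^ n))"
        by (simp add: bergman_inner_cnj)
      also have "\<dots> = (\<Sum>n\<in>{1..<N}. fourier_coeff f n * z ^ n)"
      proof (rule sum.cong)
        fix n assume "n \<in> {1..<N}"
        then have n: "n \<ge> 1" by simp
        show "of_real (?\<gamma> n) * z ^ n * bergman_inner k f (\<lambda>w. w ^ n) = fourier_coeff f n * z ^ n"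
          unfolding bergman_inner_power[OF f n k] using monomial_norm2_pos[OF n, of k] by simp
      qed simp
      also have "\<dots> = (\<Sum>n<N. fourier_coeff f n * z ^ n)"
        by (intro sum.mono_neutral_left) (auto simp: fourier_coeff_0[OF f k] not_less_eq_eq)
      finally show ?thesis by (simp add: bergman_inner_cnj)
    qed
    show "(\<lambda>N. bergman_inner k f (S N)) \<longlonglongrightarrow> f z"
      using fourier_coeff_sums[OF f k z] unfolding sums_def inner_S .
    show "(\<lambda>N. bergman_inner k f (S N)) \<longlonglongrightarrow> bergman_inner k f ?K"
      unfolding bergman_inner_def
    proof (rule integral_dominated_convergence)
      show "integrable poincare_measure
          (\<lambda>w. (cmod (f w))\<^sup>2 * log_weight w ^ k + C\<^sup>2 * ((cmod (w ^ 1))\<^sup>2 * log_weight w ^ k))"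
        by (intro Bochner_Integration.integrable_add bergman_spaceD(3)[OF f] dom)
      show "(\<lambda>w. f w * cnj (?K w) * of_real (log_weight w ^ k)) \<in> borel_measurable poincare_measure"
        using bergman_inner_integrable[OF f K] by (rule borel_measurable_integrable)
      show "(\<lambda>w. f w * cnj (S N w) * of_real (log_weight w ^ k)) \<in> borel_measurable poincare_measure" for N
        using bergman_inner_integrable[OF f S_H] by (rule borel_measurable_integrable)
      show "AE w in poincare_measure. (\<lambda>N. f w * cnj (S N w) * of_real (log_weight w ^ k)) \<longlonglongrightarrow>
          f w * cnj (?K w) * of_real (log_weight w ^ k)"
        by (intro AE_I2 tendsto_intros S_lim) simp
      show "AE w in poincare_measure. norm (f w * cnj (S N w) * of_real (log_weight w ^ k)) \<le>
          (cmod (f w))\<^sup>2 * log_weight w ^ k + C\<^sup>2 * ((cmod (w ^ 1))\<^sup>2 * log_weight w ^ k)" for N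
      proof (rule AE_I2)
        fix w assume "w \<in> space poincare_measure"
        then have w: "w \<in> punctured_disk" by simp
        have lw: "0 \<le> log_weight w ^ k" using log_weight_nonneg[OF w] by simp
        have "cmod (f w) * cmod (S N w) \<le> cmod (f w) * (C * cmod w)"
          by (intro mult_left_mono S_bound w) simp
        also have "\<dots> \<le> (cmod (f w))\<^sup>2 + (C * cmod w)\<^sup>2"
          using sum_squares_bound[of "cmod (f w)" "C * cmod w"] zero_le_power2[of "cmod (f w)"]
            zero_le_power2[of "C * cmod w"] by linarith
        finally have "cmod (f w) * cmod (S N w) * log_weight w ^ k \<le>
            ((cmod (f w))\<^sup>2 + (C * cmod w)\<^sup>2) * log_weight w ^ k"
          using lw by (rule mult_right_mono)
        moreover have "norm (f w * cnj (S N w) * of_real (log_weight w ^ k)) =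
            cmod (f w) * cmod (S N w) * log_weight w ^ k"
          using lw by (simp only: norm_mult norm_of_real complex_mod_cnj abs_of_nonneg)
        ultimately show "norm (f w * cnj (S N w) * of_real (log_weight w ^ k)) \<le>
            (cmod (f w))\<^sup>2 * log_weight w ^ k + C\<^sup>2 * ((cmod (w ^ 1))\<^sup>2 * log_weight w ^ k)"
          by (simp add: power_mult_distrib distrib_right mult.assoc)
      qed
    qed
  qed
qed

text \<open>For a member \<open>b\<close> of any basis the reproducing property gives |b z| as the
  modulus of a coefficient of the kernel function, so Parseval equates the defining sum with the
  squared norm of that function.\<close>

lemma bergman_kernel_eq:
  assumes z: "z \<in> punctured_disk" and k: "k \<ge> 2"
  shows "bergman_kernel k z = log_weight z ^ k *
    (\<Sum>n. real n ^ (k - 1) * (cmod z)\<^sup>2 ^ n) / (2 * pi * fact (k - 2))"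
proof -
  let ?K = "reproducing_kernel k z"
  define B where "B = (SOME B. bergman_orthonormal_basis k B)"
  have B: "bergman_orthonormal_basis k B"
    unfolding B_def using bergman_orthonormal_basis_monomials[OF k] by (rule someI)
  note K = reproducing_kernel_in_space[OF z k] and repr = bergman_inner_reproducing_kernel[OF z k]
  have z2: "(cmod z)\<^sup>2 < 1"
    using z by (simp add: punctured_disk_def power_less_one_iff)
  have "((\<lambda>b. (cmod (bergman_inner k ?K b))\<^sup>2) has_sum (bergman_norm k ?K)\<^sup>2) B"
    by (rule parseval_identity[OF B K])
  moreover have "(cmod (bergman_inner k ?K b))\<^sup>2 = (cmod (b z))\<^sup>2" if "b \<in> B" for b
  proof -
    have "b \<in> bergman_space k"
      using B that by (auto simp: bergman_orthonormal_basis_def)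
    then have "bergman_inner k ?K b = cnj (b z)"
      using bergman_inner_cnj[of k b ?K] by (simp add: repr)
    then show ?thesis by simp
  qed
  ultimately have "((\<lambda>b. (cmod (b z))\<^sup>2) has_sum (bergman_norm k ?K)\<^sup>2) B"
    by (simp cong: has_sum_cong)
  then have "bergman_kernel k z = log_weight z ^ k * (bergman_norm k ?K)\<^sup>2"
    by (simp add: bergman_kernel_def B_def infsumI)
  moreover have "(bergman_norm k ?K)\<^sup>2 = (\<Sum>n. real n ^ (k - 1) * (cmod z)\<^sup>2 ^ n) / (2 * pi * fact (k - 2))"
  proof -
    \<comment> \<open>The reproducing property is applied to the kernel function itself.\<close>
    have "complex_of_real ((bergman_norm k ?K)\<^sup>2) = ?K z"
      using bergman_inner_self[of k ?K] repr[OF K] by simp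
    also have "\<dots> = (\<Sum>n. complex_of_real (1 / monomial_norm2 k n * (cmod z)\<^sup>2 ^ n))"
      unfolding reproducing_kernel_def of_real_mult of_real_power[of "(cmod z)\<^sup>2"] complex_norm_square ..
    also have "\<dots> = of_real (\<Sum>n. 1 / monomial_norm2 k n * (cmod z)\<^sup>2 ^ n)"
      by (rule suminf_of_real[symmetric]) (intro summable_inverse_monomial_norm2 z2 zero_le_power2)
    finally have "(bergman_norm k ?K)\<^sup>2 = (\<Sum>n. 1 / monomial_norm2 k n * (cmod z)\<^sup>2 ^ n)"
      by (simp only: of_real_eq_iff)
    also have "\<dots> = (\<Sum>n. real n ^ (k - 1) * (cmod z)\<^sup>2 ^ n / (2 * pi * fact (k - 2)))"
      unfolding inverse_monomial_norm2 by simp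
    also have "\<dots> = (\<Sum>n. real n ^ (k - 1) * (cmod z)\<^sup>2 ^ n) / (2 * pi * fact (k - 2))"
      by (intro suminf_divide summable_power_mult_geometric z2) simp
    finally show ?thesis .
  qed
  ultimately show ?thesis by simp
qed

subsection \<open>The Lipschitz summation formula\<close>

lemma upper_half_plane_not_Ints:
  fixes w :: complex
  assumes "0 < Im w"
  shows "w \<notin> \<int>\<^sub>\<le>\<^sub>0" "1 - w \<notin> \<int>\<^sub>\<le>\<^sub>0"
  using assms by (auto elim!: nonpos_Ints_cases simp: complex_eq_iff)

text \<open>Logarithmic derivative of Euler's reflection formula, taken for the entire function
  \<open>rGamma\<close>: the product rgamma(w) rgamma(1 - w) = sin (pi w) / pi is differentiated in
  two ways.\<close>

lemma Digamma_reflection: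
  fixes w :: complex
  assumes w: "w \<notin> \<int>"
  shows "Digamma (1 - w) - Digamma w = pi * cot (pi * w)"
proof -
  have 1: "w \<notin> \<int>\<^sub>\<le>\<^sub>0" "1 - w \<notin> \<int>\<^sub>\<le>\<^sub>0"
    using w by (metis Ints_1 Ints_diff nonpos_Ints_Int diff_diff_eq2 add_diff_cancel_left')+
  have "((\<lambda>z. rGamma z * rGamma (1 - z)) has_field_derivative
      rGamma w * rGamma (1 - w) * (Digamma (1 - w) - Digamma w)) (at w)"
    using 1 by (auto intro!: derivative_eq_intros simp: algebra_simps)
  moreover have "((\<lambda>z. rGamma z * rGamma (1 - z)) has_field_derivative cos (pi * w)) (at w)"
    unfolding rGamma_reflection_complex by (auto intro!: derivative_eq_intros)
  ultimately have "rGamma w * rGamma (1 - w) * (Digamma (1 - w) - Digamma w) = cos (pi * w)"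
    by (rule DERIV_unique)
  then have eq: "sin (pi * w) * (Digamma (1 - w) - Digamma w) = pi * cos (pi * w)"
    unfolding rGamma_reflection_complex by (simp add: field_simps)
  have "sin (pi * w) \<noteq> 0"
    using w 1 rGamma_reflection_complex[of w] by (auto simp: rGamma_eq_zero_iff)
  with eq show ?thesis by (simp add: cot_def field_simps)
qed

text \<open>With q = exp (2 pi i w) Euler's formulas give cot (pi w) = i (1 - 2 / (1 - q)), and |q|
  < 1 in the upper half-plane makes 1 / (1 - q) a geometric series.\<close>

lemma cot_pi_upper_half_plane:
  fixes w :: complex
  assumes "0 < Im w"
  shows "pi * cot (pi * w) = - 2 * pi * \<i> * (\<Sum>n. exp (2 * pi * \<i> * w) ^ n) + pi * \<i>"
proof -
  define p where "p = exp (\<i> * (pi * w))"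
  let ?q = "exp (2 * pi * \<i> * w)"
  have q: "?q = p\<^sup>2" by (simp add: p_def exp_double[symmetric] mult_ac)
  have norm_q: "norm ?q < 1" using assms by simp
  then have q1: "?q \<noteq> 1" by (metis norm_one less_irrefl)
  have S: "(\<Sum>n. ?q ^ n) = 1 / (1 - ?q)"
    by (rule suminf_geometric[OF norm_q])
  have p0: "p \<noteq> 0" by (simp add: p_def)
  have "cot (pi * w) = ((p + 1 / p) / 2) / ((p - 1 / p) / (2 * \<i>))"
    by (simp add: cot_def cos_exp_eq sin_exp_eq p_def exp_minus field_simps)
  also have "\<dots> = \<i> * ((p\<^sup>2 + 1) / (p\<^sup>2 - 1))"
    using p0 q1 q by (simp add: divide_simps power2_eq_square)
  also have "\<dots> = \<i> * (1 - 2 / (1 - ?q))"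
    using q1 by (simp add: q[symmetric] divide_simps) (simp add: algebra_simps)
  finally have c: "cot (pi * w) = \<i> * (1 - 2 / (1 - ?q))" .
  show ?thesis unfolding S c by (simp add: right_diff_distrib)
qed

text \<open>The operator q d/dq multiplies the n-th term by n. Only \<open>q * D\<close> is
  described, as this is the combination that the chain rule produces for q = exp (2 pi i w).\<close>

lemma has_field_derivative_power_series_nat_power:
  fixes q :: complex
  assumes q: "norm q < 1"
  obtains D where "((\<lambda>q. \<Sum>n. of_nat n ^ m * q ^ n) has_field_derivative D) (at q)"
    and "q * D = (\<Sum>n. of_nat n ^ Suc m * q ^ n)"
proof -
  have sm: "summable (\<lambda>n. of_nat n ^ m * x ^ n)" if "norm x < 1" for m and x :: complex
    by (rule summable_norm_cancel)
      (use summable_power_mult_geometric[OF norm_ge_zero that, of m] in \<open>simp add: norm_mult norm_power\<close>)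
  let ?c = "\<lambda>n. (of_nat n ^ m :: complex)"
  define K :: complex where "K = of_real ((1 + norm q) / 2)"
  have K: "norm K = (1 + norm q) / 2" unfolding K_def norm_of_real by simp
  have "norm K < 1" "norm q < norm K" using q by (auto simp: K)
  then have "((\<lambda>q. \<Sum>n. ?c n * q ^ n) has_field_derivative (\<Sum>n. diffs ?c n * q ^ n)) (at q)"
    by (intro termdiffs_strong sm)
  moreover have "q * (\<Sum>n. diffs ?c n * q ^ n) = (\<Sum>n. of_nat n ^ Suc m * q ^ n)"
  proof -
    have s: "summable (\<lambda>n. of_nat (Suc n) ^ Suc m * q ^ Suc n)"
      using sm[OF q, of "Suc m"] by (subst summable_Suc_iff)
    have "(\<Sum>n. of_nat n ^ Suc m * q ^ n) = (\<Sum>n. of_nat (Suc n) ^ Suc m * q ^ Suc n)"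
      using suminf_split_head[OF sm[OF q, of "Suc m"]] by simp
    also have "\<dots> = q * (\<Sum>n. diffs ?c n * q ^ n)"
    proof (cases "q = 0")
      case False
      have eq: "of_nat (Suc n) ^ Suc m * q ^ Suc n = q * (diffs ?c n * q ^ n)" for n
        by (simp add: diffs_def algebra_simps)
      have "summable (\<lambda>n. diffs ?c n * q ^ n)"
        using s False unfolding eq by (simp add: summable_cmult_iff)
      then show ?thesis unfolding eq by (rule suminf_mult)
    qed simp
    finally show ?thesis ..
  qed
  ultimately show ?thesis by (rule that)
qed

text \<open>Differentiating the case m = 0 repeatedly: both sides agree on the open half-plane, so
  their derivatives do. The sign (-1)^m comes from the inner function 1 - w, and the constant pi i
  disappears at the first differentiation.\<close>

lemma Polygamma_reflection_upper_half_plane: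
  fixes w :: complex
  assumes w: "0 < Im w"
  shows "(-1) ^ m * Polygamma m (1 - w) - Polygamma m w =
    - ((2 * pi * \<i>) ^ Suc m) * (\<Sum>n. of_nat n ^ m * exp (2 * pi * \<i> * w) ^ n)
    + (if m = 0 then pi * \<i> else 0)"
  using w
proof (induction m arbitrary: w)
  case 0
  have "w \<notin> \<int>" using 0 by (auto elim!: Ints_cases)
  then show ?case
    using Digamma_reflection[of w] cot_pi_upper_half_plane[OF 0] by simp
next
  case (Suc m)
  let ?F = "\<lambda>m w. (-1) ^ m * Polygamma m (1 - w) - Polygamma m w"
  let ?q = "\<lambda>w. exp (2 * pi * \<i> * w)"
  let ?S = "\<lambda>m q. \<Sum>n. (of_nat n ^ m * q ^ n :: complex)"
  let ?G = "\<lambda>w. - ((2 * pi * \<i>) ^ Suc m) * ?S m (?q w) + (if m = 0 then pi * \<i> else 0)"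
  note w = upper_half_plane_not_Ints[OF Suc.prems]
  have F: "(?F m has_field_derivative ?F (Suc m) w) (at w)"
    using w by (auto intro!: derivative_eq_intros)
  have "norm (?q w) < 1" using Suc.prems by simp
  then obtain D where D: "(?S m has_field_derivative D) (at (?q w))" "?q w * D = ?S (Suc m) (?q w)"
    by (rule has_field_derivative_power_series_nat_power)
  have "(?q has_field_derivative 2 * pi * \<i> * ?q w) (at w)"
    by (auto intro!: derivative_eq_intros)
  from DERIV_chain2[OF D(1) this]
  have "((\<lambda>w. ?S m (?q w)) has_field_derivative 2 * pi * \<i> * ?S (Suc m) (?q w)) (at w)"
    unfolding D(2)[symmetric] by (simp only: mult_ac)
  then have "(?G has_field_derivative
      - ((2 * pi * \<i>) ^ Suc m) * (2 * pi * \<i> * ?S (Suc m) (?q w)) + 0) (at w)"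
    by (intro DERIV_add DERIV_cmult DERIV_const)
  moreover have "(?G has_field_derivative ?F (Suc m) w) (at w)"
    by (rule has_field_derivative_transform_within_open[OF F open_halfspace_Im_gt[of 0]])
      (use Suc in auto)
  ultimately have "?F (Suc m) w = - ((2 * pi * \<i>) ^ Suc m) * (2 * pi * \<i> * ?S (Suc m) (?q w)) + 0"
    by (rule DERIV_unique[rotated])
  then show ?case by (simp add: mult_ac)
qed

text \<open>Up to sign and factorial, \<open>Polygamma k w\<close> and
  \<open>Polygamma k (1 - w)\<close> are the sums of (w + n)^(-k-1) over the nonnegative and the
  negative integers. Multiplying by w^(k+1) normalises the term at 0 to 1, and the remaining terms
  are paired as n and -n.\<close>

lemma lipschitz_formula:
  fixes w :: complex
  assumes w: "0 < Im w" and k: "k \<ge> 1"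
  defines "S \<equiv> (\<Sum>n. of_nat n ^ k * exp (2 * pi * \<i> * w) ^ n)"
  shows "(\<lambda>j. (w / (w + of_nat (Suc j))) ^ Suc k + (- w / (of_nat (Suc j) - w)) ^ Suc k)
    sums ((- 2 * pi * \<i> * w) ^ Suc k * S / fact k - 1)"
proof -
  note nI = upper_half_plane_not_Ints[OF w]
  have w0: "w \<noteq> 0" using w by auto
  have "(\<lambda>j. inverse ((w + of_nat j) ^ Suc k)) sums ((-1) ^ Suc k * Polygamma k w / fact k)"
    using nI k by (intro Polygamma_LIMSEQ) auto
  then have "(\<lambda>j. w ^ Suc k * inverse ((w + of_nat j) ^ Suc k)) sums
      (w ^ Suc k * ((-1) ^ Suc k * Polygamma k w / fact k))"
    by (rule sums_mult)
  then have "(\<lambda>j. (w / (w + of_nat j)) ^ Suc k) sums (w ^ Suc k * ((-1) ^ Suc k * Polygamma k w / fact k))"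
    by (simp only: power_mult_distrib power_inverse divide_inverse)
  \<comment> \<open>Shifting the index removes the term \<open>(w / w) ^ Suc k = 1\<close>, the main
    term of the asymptotics.\<close>
  then have 1: "(\<lambda>j. (w / (w + of_nat (Suc j))) ^ Suc k) sums
      (w ^ Suc k * ((-1) ^ Suc k * Polygamma k w / fact k) - 1)"
    using w0 by (subst sums_Suc_iff) simp
  have "(\<lambda>j. inverse ((1 - w + of_nat j) ^ Suc k)) sums ((-1) ^ Suc k * Polygamma k (1 - w) / fact k)"
    using nI k by (intro Polygamma_LIMSEQ) auto
  then have "(\<lambda>j. (- w) ^ Suc k * inverse ((1 - w + of_nat j) ^ Suc k)) sums
      ((- w) ^ Suc k * ((-1) ^ Suc k * Polygamma k (1 - w) / fact k))"
    by (rule sums_mult)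
  moreover have "1 - w + of_nat j = of_nat (Suc j) - w" for j by simp
  ultimately have 2: "(\<lambda>j. (- w / (of_nat (Suc j) - w)) ^ Suc k) sums
      ((- w) ^ Suc k * ((-1) ^ Suc k * Polygamma k (1 - w) / fact k))"
    by (simp only: power_mult_distrib power_inverse divide_inverse)
  have "(- 2 * pi * \<i> * w) ^ Suc k * S = (- w) ^ Suc k * ((2 * pi * \<i>) ^ Suc k * S)"
  proof -
    have "- 2 * pi * \<i> * w = (- w) * (2 * pi * \<i>)" by simp
    then show ?thesis by (simp only: power_mult_distrib mult.assoc)
  qed
  also have "(2 * pi * \<i>) ^ Suc k * S = Polygamma k w - (-1) ^ k * Polygamma k (1 - w)"
    using Polygamma_reflection_upper_half_plane[OF w, of k] k by (simp add: S_def algebra_simps)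
  finally have eq: "(- 2 * pi * \<i> * w) ^ Suc k * S / fact k - 1 =
      (w ^ Suc k * ((-1) ^ Suc k * Polygamma k w / fact k) - 1) +
      ((- w) ^ Suc k * ((-1) ^ Suc k * Polygamma k (1 - w) / fact k))"
    by (simp add: power_minus[of w] diff_divide_distrib right_diff_distrib mult_ac)
  show ?thesis
    unfolding eq by (rule sums_add[OF 1 2])
qed

section \<open>Estimating the remainder of the Lipschitz series\<close>

text \<open>Since \<open>w\<close> is purely imaginary, |w + n|^2 = |n - w|^2 = |w|^2 + n^2, so both
  members of a pair have the same modulus.\<close>

lemma norm_lipschitz_summand:
  fixes t :: real
  assumes t: "t > 0" and w: "w = \<i> * of_real (t / (2 * pi))"
  shows "norm ((w / (w + of_nat n)) ^ m) = (1 + (real n * (2 * pi / t))\<^sup>2) powr (- real m / 2)"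
    and "norm ((- w / (of_nat n - w)) ^ m) = (1 + (real n * (2 * pi / t))\<^sup>2) powr (- real m / 2)"
proof -
  let ?s = "t / (2 * pi)" and ?A = "1 + (real n * (2 * pi / t))\<^sup>2"
  have s: "?s > 0" using t by simp
  have A: "?A > 0" by (simp add: add_pos_nonneg)
  have nw: "cmod w = ?s" using t unfolding w norm_mult norm_of_real by simp
  have w_parts: "Re w = 0" "Im w = ?s" by (simp_all add: w)
  have "?s\<^sup>2 + (real n)\<^sup>2 = ?s\<^sup>2 * ?A" using t by (simp add: field_simps power2_eq_square)
  then have sq: "sqrt (?s\<^sup>2 + (real n)\<^sup>2) = ?s * sqrt ?A"
    by (simp only: real_sqrt_mult real_sqrt_abs abs_of_pos[OF s])
  have den: "cmod (w + of_nat n) = ?s * sqrt ?A" "cmod (of_nat n - w) = ?s * sqrt ?A"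
    unfolding sq[symmetric] cmod_def by (simp_all add: w_parts add.commute)
  have "(?s / (?s * sqrt ?A)) ^ m = (1 / sqrt ?A) ^ m" using t by simp
  also have "\<dots> = (?A powr (- 1 / 2)) ^ m"
    using A by (simp add: powr_minus powr_half_sqrt inverse_eq_divide)
  also have "\<dots> = ?A powr (- real m / 2)"
    using A by (subst powr_power) auto
  finally have eq: "(?s / (?s * sqrt ?A)) ^ m = ?A powr (- real m / 2)" .
  show "norm ((w / (w + of_nat n)) ^ m) = ?A powr (- real m / 2)"
      "norm ((- w / (of_nat n - w)) ^ m) = ?A powr (- real m / 2)"
    unfolding norm_power norm_divide norm_minus_cancel den nw eq by (rule refl)+
qed

text \<open>Integral comparison carried out with the mean value theorem. The extra factor y \<ge> 1
  only enlarges the integrand and makes it the derivative of an elementary function.\<close>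

lemma sum_powr_tail_bound:
  fixes x p :: real
  assumes x: "x > 0" and p: "p > 1"
  shows "(\<Sum>j<n. (1 + (real (Suc j) * x)\<^sup>2) powr (- p)) \<le>
    (1 + x\<^sup>2) powr (- p) + (1 + x\<^sup>2) powr (1 - p) / (2 * x\<^sup>2 * (p - 1))"
proof -
  \<comment> \<open>\<open>G y\<close> is the integral of u (1 + (u x)^2)^(-p) over u \<ge> y,
    convergent because p > 1.\<close>
  define G where "G = (\<lambda>y. (1 + (y * x)\<^sup>2) powr (1 - p) / (2 * x\<^sup>2 * (p - 1)))"
  have pos: "1 + (y * x)\<^sup>2 > 0" for y by (simp add: add_pos_nonneg)
  have G_nonneg: "0 \<le> G y" for y using p by (simp add: G_def)
  have G': "(G has_real_derivative - (y * (1 + (y * x)\<^sup>2) powr (- p))) (at y)" for y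
  proof -
    have "((\<lambda>y. 1 + (y * x)\<^sup>2) has_real_derivative 2 * y * x\<^sup>2) (at y)"
      by (auto intro!: derivative_eq_intros simp: power2_eq_square)
    from DERIV_chain2[OF has_real_derivative_powr[OF pos] this]
    have "(G has_real_derivative ((1 - p) * (1 + (y * x)\<^sup>2) powr (1 - p - 1) * (2 * y * x\<^sup>2))
        / (2 * x\<^sup>2 * (p - 1))) (at y)"
      unfolding G_def by (rule DERIV_cdivide)
    moreover have "((1 - p) * B * (2 * y * x\<^sup>2)) / (2 * x\<^sup>2 * (p - 1)) = - (y * B)" for B
      using x p by (simp add: divide_simps) (simp add: algebra_simps)
    ultimately show ?thesis by simp
  qed
  have step: "(1 + (real (Suc (Suc j)) * x)\<^sup>2) powr (- p) \<le> G (real (Suc j)) - G (real (Suc (Suc j)))" for j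
  proof -
    let ?a = "real (Suc j)" and ?b = "real (Suc (Suc j))"
    obtain y where y: "?a < y" "y < ?b" "G ?b - G ?a = (?b - ?a) * (- (y * (1 + (y * x)\<^sup>2) powr (- p)))"
      using MVT2[of ?a ?b G "\<lambda>y. - (y * (1 + (y * x)\<^sup>2) powr (- p))"] G' by auto
    have "1 + (y * x)\<^sup>2 \<le> 1 + (?b * x)\<^sup>2"
      using y x by (intro add_left_mono power_mono mult_right_mono) auto
    then have "(1 + (?b * x)\<^sup>2) powr (- p) \<le> (1 + (y * x)\<^sup>2) powr (- p)"
      using pos[of y] p by (intro powr_mono2') auto
    also have "\<dots> \<le> y * (1 + (y * x)\<^sup>2) powr (- p)"
      using y by (intro mult_le_cancel_right1[THEN iffD2]) auto
    also have "\<dots> = G ?a - G ?b" using y(3) by simp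
    finally show ?thesis .
  qed
  \<comment> \<open>One more nonnegative term is added so that \<open>j = 0\<close> can be split off
    even when \<open>n = 0\<close>.\<close>
  have "(\<Sum>j<n. (1 + (real (Suc j) * x)\<^sup>2) powr (- p)) \<le> (\<Sum>j<Suc n. (1 + (real (Suc j) * x)\<^sup>2) powr (- p))"
    by simp
  also have "\<dots> = (1 + x\<^sup>2) powr (- p) + (\<Sum>j<n. (1 + (real (Suc (Suc j)) * x)\<^sup>2) powr (- p))"
    by (subst sum.lessThan_Suc_shift) simp
  also have "(\<Sum>j<n. (1 + (real (Suc (Suc j)) * x)\<^sup>2) powr (- p)) \<le> (\<Sum>j<n. G (real (Suc j)) - G (real (Suc (Suc j))))"
    by (intro sum_mono step)
  also have "\<dots> = G 1 - G (real (Suc n))"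
    using sum_lessThan_telescope'[of "\<lambda>j. G (real (Suc j))" n] by simp
  also have "\<dots> \<le> G 1" using G_nonneg by simp
  finally show ?thesis by (simp add: G_def)
qed

lemma lipschitz_error_bound:
  fixes t :: real
  assumes t: "t > 0" and k: "k \<ge> 2"
  shows "\<bar>t ^ Suc k * (\<Sum>n. real n ^ k * exp (- t) ^ n) / fact k - 1\<bar> <
    (t\<^sup>2 / (pi\<^sup>2 * (real k - 1)) + 2 * ((real k + 1) / (real k - 1)))
      * (1 + (2 * pi / t)\<^sup>2) powr (- (real k + 1) / 2)"
proof -
  \<comment> \<open>This choice makes 2 pi i w = -t, so the exponentials become powers of exp (-t)
    and the prefactor becomes t^(k+1).\<close>
  define w where "w = \<i> * of_real (t / (2 * pi))"
  define x where "x = 2 * pi / t"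
  define p where "p = (real k + 1) / 2"
  have x: "x > 0" using t by (simp add: x_def)
  have p: "p > 1" using k by (simp add: p_def)
  have w_pos: "0 < Im w" using t by (simp add: w_def)
  have u: "- 2 * pi * \<i> * w = of_real t"
    using t by (simp add: w_def)
  have q: "exp (2 * pi * \<i> * w) = of_real (exp (- t))"
    using u by (simp add: exp_of_real[symmetric]) (metis minus_mult_left minus_minus)
  let ?S = "\<Sum>n. real n ^ k * exp (- t) ^ n"
  let ?h = "\<lambda>j. (w / (w + of_nat (Suc j))) ^ Suc k + (- w / (of_nat (Suc j) - w)) ^ Suc k"
  let ?a = "\<lambda>j. (1 + (real (Suc j) * x)\<^sup>2) powr (- p)"
  have S: "(\<Sum>n. of_nat n ^ k * exp (2 * pi * \<i> * w) ^ n) = of_real ?S"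
    unfolding q using t
    by (subst suminf_of_real) (auto intro!: summable_power_mult_geometric)
  have sums: "?h sums of_real (t ^ Suc k * ?S / fact k - 1)"
    using lipschitz_formula[OF w_pos, of k] k unfolding S u by simp
  have mp: "- real (Suc k) / 2 = - p" unfolding p_def by (simp add: field_simps)
  have norm_h: "norm (?h j) \<le> 2 * ?a j" for j
    using norm_triangle_ineq[of "(w / (w + of_nat (Suc j))) ^ Suc k" "(- w / (of_nat (Suc j) - w)) ^ Suc k"]
    unfolding norm_lipschitz_summand[OF t w_def, of "Suc j" "Suc k"] mp x_def[symmetric] by simp
  let ?T = "(1 + x\<^sup>2) powr (- p) + (1 + x\<^sup>2) powr (1 - p) / (2 * x\<^sup>2 * (p - 1))"
  have "norm (complex_of_real (t ^ Suc k * ?S / fact k - 1)) \<le> 2 * ?T"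
  proof (rule LIMSEQ_le_const2)
    show "(\<lambda>n. norm (\<Sum>j<n. ?h j)) \<longlonglongrightarrow> norm (complex_of_real (t ^ Suc k * ?S / fact k - 1))"
      using sums unfolding sums_def by (rule tendsto_norm)
    have "norm (\<Sum>j<n. ?h j) \<le> 2 * ?T" for n
    proof -
      have "norm (\<Sum>j<n. ?h j) \<le> (\<Sum>j<n. 2 * ?a j)"
        by (rule sum_norm_le) (rule norm_h)
      also have "\<dots> = 2 * (\<Sum>j<n. ?a j)" by (rule sum_distrib_left[symmetric])
      also have "\<dots> \<le> 2 * ?T" by (intro mult_left_mono sum_powr_tail_bound[OF x p]) simp
      finally show ?thesis .
    qed
    then show "\<exists>N. \<forall>n\<ge>N. norm (\<Sum>j<n. ?h j) \<le> 2 * ?T" by blast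
  qed
  then have "\<bar>t ^ Suc k * ?S / fact k - 1\<bar> \<le> 2 * ?T"
    by (simp only: norm_of_real)
  also have "2 * ?T < (t\<^sup>2 / (pi\<^sup>2 * (real k - 1)) + 2 * ((real k + 1) / (real k - 1))) * (1 + x\<^sup>2) powr (- p)"
  proof -
    define A where "A = (1 + x\<^sup>2) powr (- p)"
    have x2: "x\<^sup>2 > 0" using x by simp
    have nz: "1 + x\<^sup>2 \<noteq> 0" using x2 by linarith
    then have A: "A > 0" by (simp add: A_def)
    have "(1 + x\<^sup>2) powr (1 - p) = (1 + x\<^sup>2) * A"
      unfolding A_def using powr_add[of "1 + x\<^sup>2" 1 "- p"] x2 nz by simp
    then have T: "2 * ?T = A * (2 + (1 + x\<^sup>2) / (x\<^sup>2 * (p - 1)))"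
      unfolding A_def[symmetric] using x2 p by (simp add: field_simps)
    have p1: "p - 1 = (real k - 1) / 2" by (simp add: p_def field_simps)
    have k1: "real k - 1 > 0" using k by simp
    have t2: "t\<^sup>2 / pi\<^sup>2 = 4 / x\<^sup>2" using t by (simp add: x_def power_divide power_mult_distrib)
    have "(1 + x\<^sup>2) / (x\<^sup>2 * (p - 1)) = 2 / (x\<^sup>2 * (real k - 1)) + 2 / (real k - 1)"
    proof -
      have "(1 + y) / (y * (c / 2)) = 2 / (y * c) + 2 / c" if "y > 0" "c > 0" for y c :: real
        using that by (simp add: field_simps)
      from this[OF x2 k1] show ?thesis unfolding p1 .
    qed
    moreover have "t\<^sup>2 / (pi\<^sup>2 * (real k - 1)) = 4 / (x\<^sup>2 * (real k - 1))"
      using t2 by (metis divide_divide_eq_left)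
    moreover have "2 * ((real k + 1) / (real k - 1)) = 2 + 4 / (real k - 1)"
      using k1 by (simp add: field_simps)
    \<comment> \<open>The target carries 4 where the tail estimate needs only 2; strictness comes
      from here.\<close>
    moreover have "2 / (x\<^sup>2 * (real k - 1)) < 4 / (x\<^sup>2 * (real k - 1))" "2 / (real k - 1) < 4 / (real k - 1)"
      using x2 k1 by (simp_all add: divide_strict_right_mono)
    ultimately have "2 + (1 + x\<^sup>2) / (x\<^sup>2 * (p - 1)) <
        t\<^sup>2 / (pi\<^sup>2 * (real k - 1)) + 2 * ((real k + 1) / (real k - 1))"
      by linarith
    then show ?thesis
      unfolding T unfolding A_def[symmetric] mult.commute[of _ A] using A by (rule mult_strict_left_mono)
  qed
  finally show ?thesis
    by (simp add: x_def p_def minus_divide_left)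
qed


theorem theorem1p3:
  fixes k :: nat
  assumes "k \<ge> 2"
  shows "\<exists>\<epsilon> :: real \<Rightarrow> real. \<forall>z :: complex. 0 < cmod z \<and> cmod z < 1 \<longrightarrow>
    (let t = - ln ((cmod z)\<^sup>2) in
       bergman_kernel (k + 1) z = real k / (2 * pi) * (1 + \<epsilon> t) \<and>
       \<bar>\<epsilon> t\<bar> < (t\<^sup>2 / (pi\<^sup>2 * (real k - 1)) + 2 * ((real k + 1) / (real k - 1)))
                 * (1 + (2 * pi / t)\<^sup>2) powr (- (real k + 1) / 2))"
\<comment> \<open>The witness is the exact relative error; it is a function of t alone because the
  kernel is radial.\<close>
proof (rule exI[of _ "\<lambda>t. t ^ Suc k * (\<Sum>n. real n ^ k * exp (- t) ^ n) / fact k - 1"], intro allI impI)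
  let ?S = "\<lambda>t. \<Sum>n. real n ^ k * exp (- t) ^ n"
  fix z :: complex assume "0 < cmod z \<and> cmod z < 1"
  then have z: "z \<in> punctured_disk" by (simp add: punctured_disk_def)
  then have z0: "z \<noteq> 0" by auto
  define t where "t = log_weight z"
  have t: "t > 0" unfolding t_def by (rule log_weight_pos[OF z])
  have t_eq: "- ln ((cmod z)\<^sup>2) = t"
    using z0 by (simp add: t_def log_weight_def ln_div)
  have k1: "Suc (k - 1) = k" using assms by simp
  have "fact k = real k * fact (k - 1)"
    by (subst k1[symmetric], subst fact_Suc) (simp only: k1 of_nat_mult)
  moreover have "bergman_kernel (k + 1) z = t ^ Suc k * ?S t / (2 * pi * fact (k - 1))"
    using bergman_kernel_eq[OF z, of "k + 1"] assms by (simp add: t_def exp_log_weight[OF z0])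
  ultimately have "bergman_kernel (k + 1) z = real k / (2 * pi) * (1 + (t ^ Suc k * ?S t / fact k - 1))"
    using assms by simp
  then show "let t = - ln ((cmod z)\<^sup>2) in
       bergman_kernel (k + 1) z = real k / (2 * pi) * (1 + (t ^ Suc k * ?S t / fact k - 1)) \<and>
       \<bar>t ^ Suc k * ?S t / fact k - 1\<bar> < (t\<^sup>2 / (pi\<^sup>2 * (real k - 1)) + 2 * ((real k + 1) / (real k - 1)))
                 * (1 + (2 * pi / t)\<^sup>2) powr (- (real k + 1) / 2)"
    unfolding Let_def t_eq using lipschitz_error_bound[OF t assms] by (rule conjI)
qed

end
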